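(* Let $1\leq k\leq n$ be integers, and let $p,q$ be real numbers with $1<p\leq k+1$ and $q\leq k+1$. Let $f$ be a positive smooth function on $\mathbb{S}^n$ and suppose $h$ is a positive, smooth and strictly convex solution to $$\sigma_{k}(\nabla^{2}h+hI)=f\,h^{p-1}\,(h^{2}+|\nabla h|^{2})^{\frac{k+1-q}{2}}\quad\text{on }\mathbb{S}^n .$$ Then for any $\gamma$ with $0<\gamma<2(p-1)/k\leq 2$ there exists a constant $M\geq 2$, depending on $\gamma$, $k$, $\min_{\mathbb{S}^n}f$ and $\|f\|_{C^{1}(\mathbb{S}^n)}$, such that $$\frac{h^{2}+|\nabla h|^{2}}{h^{\gamma}}\leq M R^{2-\gamma}\quad\text{on }\mathbb{S}^n,$$ where $R=\max_{\mathbb{S}^n}h$.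
   Context: $\mathbb{S}^n$ is the unit sphere in $\mathbb{R}^{n+1}$ with its round metric; $\nabla$ and $\nabla^2$ are the spherical gradient and covariant Hessian, and $I$ is the identity matrix (with respect to local orthonormal frames). For a symmetric $n\times n$ matrix $P$ with eigenvalues $\Lambda_1,\dots,\Lambda_n$, $\sigma_k(P)=\sum_{1\le i_1<\dots<i_k\le n}\Lambda_{i_1}\cdots\Lambda_{i_k}$. The function $h$ is strictly convex if $\nabla^2h+hI$ is positive definite everywhere on $\mathbb{S}^n$. The parameters $n,k,p,q$ are fixed; the constant $M$ does not depend on the solution $h$. *)

theory Defs
  imports "HOL-Analysis.Analysis" "Jordan_Normal_Form.Char_Poly"
begin

text \<open>
  The sphere \<open>S\<^sup>n\<close> is \<^term>\<open>sphere (0::'a::euclidean_space) 1\<close> with \<open>DIM('a) = n + 1\<close>.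
  Functions on it are total functions \<open>'a \<Rightarrow> real\<close> of which only the values on the sphere are used.
  The infix inner product is shadowed by the one of \<^theory>\<open>Jordan_Normal_Form.Matrix\<close>, so
  \<^const>\<open>inner\<close> is written in prefix form.
\<close>

fun C_diff_on :: "nat \<Rightarrow> 'a::euclidean_space set \<Rightarrow> ('a \<Rightarrow> real) \<Rightarrow> bool" where
  "C_diff_on 0 U F \<longleftrightarrow> continuous_on U F"
| "C_diff_on (Suc m) U F \<longleftrightarrow>
     (\<forall>x\<in>U. F differentiable (at x)) \<and>
     (\<forall>v. C_diff_on m U (\<lambda>x. frechet_derivative F (at x) v))"

text \<open>Smoothness on the embedded submanifold \<open>S\<^sup>n\<close>: existence of a smooth extension to an open
  neighbourhood in the ambient space.\<close>

definition smooth_on_sphere :: "('a::euclidean_space \<Rightarrow> real) \<Rightarrow> bool" where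
  "smooth_on_sphere h \<longleftrightarrow>
     (\<exists>U F. open U \<and> sphere 0 1 \<subseteq> U \<and> (\<forall>m. C_diff_on m U F) \<and> (\<forall>x\<in>sphere 0 1. F x = h x))"

definition tangent_proj :: "'a::euclidean_space \<Rightarrow> 'a \<Rightarrow> 'a" where
  "tangent_proj x v = v - inner v x *\<^sub>R x"

text \<open>A derivative within the sphere is determined by the function only on tangent vectors.
  Requiring the representing vector to be tangent makes the gradient unique.\<close>

definition sphere_grad :: "('a::euclidean_space \<Rightarrow> real) \<Rightarrow> 'a \<Rightarrow> 'a" where
  "sphere_grad h x =
     (THE g. inner g x = 0 \<and> (h has_derivative (\<lambda>v. inner g v)) (at x within sphere 0 1))"

text \<open>The Levi-Civita connection of the round metric is the tangential part of the ambient
  derivative; it is used only for \<open>u\<close> tangent at \<open>x\<close>, where the derivative within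
  the sphere is unambiguous.\<close>

definition sphere_cov :: "('a::euclidean_space \<Rightarrow> 'a) \<Rightarrow> 'a \<Rightarrow> 'a \<Rightarrow> 'a" where
  "sphere_cov V x u = tangent_proj x (frechet_derivative V (at x within sphere 0 1) u)"

definition sphere_hess :: "('a::euclidean_space \<Rightarrow> real) \<Rightarrow> 'a \<Rightarrow> 'a \<Rightarrow> 'a \<Rightarrow> real" where
  "sphere_hess h x u v = inner (sphere_cov (sphere_grad h) x u) v"

text \<open>The bilinear form \<open>\<nabla>\<^sup>2h + hI\<close> on the tangent space at \<open>x\<close>.\<close>

definition hess_plus :: "('a::euclidean_space \<Rightarrow> real) \<Rightarrow> 'a \<Rightarrow> 'a \<Rightarrow> 'a \<Rightarrow> real" where
  "hess_plus h x u v = sphere_hess h x u v + h x * inner u v"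

definition strictly_convex_on_sphere :: "('a::euclidean_space \<Rightarrow> real) \<Rightarrow> bool" where
  "strictly_convex_on_sphere h \<longleftrightarrow>
     (\<forall>x\<in>sphere 0 1. \<forall>v. inner v x = 0 \<and> v \<noteq> 0 \<longrightarrow> hess_plus h x v v > 0)"

text \<open>When \<open>DIM('a) = n + 1\<close>, such \<open>n\<close> vectors form an orthonormal basis of the tangent space.\<close>

definition tangent_frame :: "nat \<Rightarrow> 'a::euclidean_space \<Rightarrow> (nat \<Rightarrow> 'a) \<Rightarrow> bool" where
  "tangent_frame n x e \<longleftrightarrow>
     (\<forall>i<n. inner (e i) x = 0) \<and>
     (\<forall>i<n. \<forall>j<n. inner (e i) (e j) = (if i = j then 1 else 0))"

definition frame_matrix ::
    "nat \<Rightarrow> (nat \<Rightarrow> 'a::euclidean_space) \<Rightarrow> ('a \<Rightarrow> 'a \<Rightarrow> real) \<Rightarrow> real Matrix.mat" where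
  "frame_matrix n e B = Matrix.mat n n (\<lambda>(i, j). B (e i) (e j))"

text \<open>All real eigenvalues, repeated according to multiplicity; a symmetric \<open>n \<times> n\<close> matrix has
  exactly \<open>n\<close> of them.\<close>

definition eigenvalue_list :: "real Matrix.mat \<Rightarrow> real list" where
  "eigenvalue_list P = sorted_list_of_multiset (proots (char_poly P))"

definition sigma_k :: "nat \<Rightarrow> real Matrix.mat \<Rightarrow> real" where
  "sigma_k k P =
     (let \<Lambda> = eigenvalue_list P
      in \<Sum>J | J \<subseteq> {..<length \<Lambda>} \<and> card J = k. \<Prod>i\<in>J. \<Lambda> ! i)"

definition C1_norm :: "('a::euclidean_space \<Rightarrow> real) \<Rightarrow> real" where
  "C1_norm f = (SUP x\<in>sphere 0 1. \<bar>f x\<bar>) + (SUP x\<in>sphere 0 1. norm (sphere_grad f x))"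

end

theory Submission
  imports Defs
begin

text \<open>
  Extend \<open>h\<close> to a function \<open>H\<close> on the punctured space that is homogeneous of degree one. On the
  sphere the Euclidean gradient of \<open>H\<close> is \<open>\<nabla>h + h x\<close>, so \<open>h\<^sup>2 + \<bar>\<nabla>h\<bar>\<^sup>2 = \<bar>DH\<bar>\<^sup>2\<close>, and the Euclidean
  Hessian \<open>D\<^sup>2H\<close> restricted to the tangent space is \<open>\<nabla>\<^sup>2h + hI\<close> (lemmas \<open>sphere_grad_eq\<close>,
  \<open>square_plus_norm_sphere_grad\<close> and \<open>hess_plus_eq\<close>). The Codazzi equation for \<open>\<nabla>\<^sup>2h + hI\<close> becomes
  the symmetry of the third derivative of \<open>H\<close>, and no curvature terms appear.

  Let \<open>x\<close> be a point where \<open>\<bar>DH\<bar>\<^sup>2 / h\<^sup>\<gamma>\<close> is maximal on the sphere, write \<open>w = \<nabla>h\<close>,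
  \<open>\<rho>\<^sup>2 = \<bar>DH\<bar>\<^sup>2\<close> and \<open>B = \<nabla>\<^sup>2h + hI\<close>, all at \<open>x\<close>. The first-order condition says that \<open>w\<close> satisfies
  \<open>B w = (\<gamma> \<rho>\<^sup>2 / 2h) w\<close>. Combined with it, the second-order condition gives an inequality between
  quadratic forms: the derivative of \<open>D\<^sup>2H\<close> in the direction \<open>w\<close> is at most \<open>c B\<close> with
  \<open>c = h + \<gamma> \<rho>\<^sup>2 / 2h\<close>, with a slack proportional to the identity (\<open>max_point_hessian_bound\<close>).

  Hence, moving from \<open>x\<close> in the direction \<open>w\<close> for a short time \<open>t\<close>, the form \<open>D\<^sup>2H\<close> stays below
  \<open>(1 + ct) B\<close>. By the minimax comparison of ordered eigenvalues (\<open>eigenvalue_comparison\<close>) every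
  eigenvalue grows at most by the factor \<open>1 + ct\<close>, up to terms of second order in \<open>t\<close>, and so \<open>\<sigma>\<^sub>k\<close> grows at
  most by \<open>(1 + ct)\<^sup>k\<close> (\<open>elem_sym_growth\<close>). This monotonicity argument takes the place of
  differentiating \<open>\<sigma>\<^sub>k\<close>. On the other hand the equation expresses \<open>\<sigma>\<^sub>k\<close> through \<open>f\<close>, \<open>h\<close> and \<open>\<rho>\<close>,
  whose logarithmic derivatives along \<open>w\<close> are known at \<open>x\<close>. The one coming from \<open>\<rho>\<close> is nonnegative
  because \<open>q \<le> k + 1\<close>, and comparing the two growth rates at \<open>t = 0\<close> yields
  \<open>(p - 1) \<bar>w\<bar>\<^sup>2 / h \<le> (\<bar>\<nabla>f\<bar> / f) \<bar>w\<bar> + k (h + \<gamma> \<rho>\<^sup>2 / 2h)\<close> (\<open>max_point_estimate\<close>).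

  Since \<open>\<bar>w\<bar>\<^sup>2 = \<rho>\<^sup>2 - h\<^sup>2\<close>, the coefficient of \<open>\<rho>\<^sup>2\<close> after multiplication by \<open>2h\<close> is
  \<open>2(p - 1) - k\<gamma>\<close>, which is positive by hypothesis. Therefore \<open>\<rho> \<le> A h\<close> at \<open>x\<close>, with \<open>A\<close> depending only
  on \<open>p, k, \<gamma>, min f\<close> and the \<open>C\<^sup>1\<close> norm of \<open>f\<close>, and the maximal value of \<open>\<rho>\<^sup>2 / h\<^sup>\<gamma>\<close> is at most
  \<open>A\<^sup>2 h\<^sup>2\<^sup>-\<^sup>\<gamma> \<le> A\<^sup>2 R\<^sup>2\<^sup>-\<^sup>\<gamma>\<close>; the last step uses \<open>\<gamma> < 2\<close>, a consequence of \<open>p \<le> k + 1\<close>.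
\<close>

section \<open>Smooth functions and their directional derivatives\<close>

definition dird :: "'a::euclidean_space \<Rightarrow> ('a \<Rightarrow> real) \<Rightarrow> 'a \<Rightarrow> real" where
  "dird v F x = frechet_derivative F (at x) v"

definition smooth_on :: "'a::euclidean_space set \<Rightarrow> ('a \<Rightarrow> real) \<Rightarrow> bool" where
  "smooth_on U F \<longleftrightarrow> (\<forall>m. C_diff_on m U F)"

lemma dird_eqI: "(F has_derivative F') (at x) \<Longrightarrow> dird v F x = F' v"
  unfolding dird_def using frechet_derivative_at by metis

lemma C_diff_on_Suc_dird:
  "C_diff_on (Suc m) U F \<longleftrightarrow> (\<forall>x\<in>U. F differentiable (at x)) \<and> (\<forall>v. C_diff_on m U (dird v F))"
  unfolding dird_def[abs_def] by simp

declare C_diff_on.simps(2) [simp del]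

lemma C_diff_on_cong:
  assumes "open U" and "\<And>x. x \<in> U \<Longrightarrow> F x = G x" and "C_diff_on m U F"
  shows "C_diff_on m U G"
  using assms(2,3)
proof (induction m arbitrary: F G)
  case 0
  then show ?case using continuous_on_cong[of U U F G] by auto
next
  case (Suc m)
  have tr: "(G has_derivative F') (at x)" if "x \<in> U" "(F has_derivative F') (at x)" for x F'
    using has_derivative_transform_within_open[OF that(2) assms(1) that(1)] Suc.prems(1) by auto
  have d: "\<And>x. x \<in> U \<Longrightarrow> F differentiable (at x)" and
    c: "\<And>v. C_diff_on m U (dird v F)"
    using Suc.prems(2) by (auto simp: C_diff_on_Suc_dird)
  have "G differentiable (at x)" if "x \<in> U" for x
    using tr d that unfolding differentiable_def by blast
  moreover have "C_diff_on m U (dird v G)" for v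
  proof (rule Suc.IH[OF _ c[of v]])
    fix x assume x: "x \<in> U"
    then obtain F' where F': "(F has_derivative F') (at x)"
      using d unfolding differentiable_def by blast
    show "dird v F x = dird v G x"
      using dird_eqI[OF F'] dird_eqI[OF tr[OF x F']] by simp
  qed
  ultimately show ?case by (simp add: C_diff_on_Suc_dird)
qed

lemma C_diff_on_SucD: "C_diff_on (Suc m) U F \<Longrightarrow> C_diff_on m U F"
proof (induction m arbitrary: F)
  case 0
  then show ?case
    by (auto simp: C_diff_on_Suc_dird intro!: differentiable_imp_continuous_on
        simp: differentiable_on_def differentiable_at_withinI)
next
  case (Suc m)
  then show ?case by (subst C_diff_on_Suc_dird) (auto simp: C_diff_on_Suc_dird[of "Suc m"])
qed

lemma C_diff_on_const: "C_diff_on m U (\<lambda>_. c)"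
proof (induction m arbitrary: c)
  case (Suc m)
  have "dird v (\<lambda>_::'a. c) = (\<lambda>_. 0)" for v
    by (rule ext) (use dird_eqI[OF has_derivative_const] in auto)
  then show ?case using Suc by (auto simp: C_diff_on_Suc_dird)
qed simp

lemma C_diff_on_inner: "C_diff_on m U (\<lambda>x. inner x c)"
proof (cases m)
  case (Suc k)
  have "dird v (\<lambda>x::'a. inner x c) = (\<lambda>_. inner v c)" for v
    by (rule ext, rule dird_eqI) (auto intro!: derivative_eq_intros)
  then show ?thesis unfolding Suc C_diff_on_Suc_dird
    by (auto simp: C_diff_on_const intro!: derivative_intros)
qed (auto intro!: continuous_intros)

lemma has_derivative_dird: "F differentiable (at x) \<Longrightarrow> (F has_derivative (\<lambda>v. dird v F x)) (at x)"
  unfolding dird_def using frechet_derivative_works[of F "at x"] by simp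

lemma C_diff_on_add:
  assumes "open U" "C_diff_on m U F" "C_diff_on m U G"
  shows "C_diff_on m U (\<lambda>x. F x + G x)"
  using assms(2,3)
proof (induction m arbitrary: F G)
  case 0
  then show ?case by (auto intro!: continuous_intros)
next
  case (Suc m)
  have d: "F differentiable (at x)" "G differentiable (at x)" if "x \<in> U" for x
    using Suc.prems that by (auto simp: C_diff_on_Suc_dird)
  have e: "dird v F x + dird v G x = dird v (\<lambda>x. F x + G x) x" if "x \<in> U" for x v
    by (rule dird_eqI[symmetric]) (intro has_derivative_add has_derivative_dird d that)
  have "C_diff_on m U (dird v (\<lambda>x. F x + G x))" for v
    by (rule C_diff_on_cong[OF assms(1) e Suc.IH]) (use Suc.prems in \<open>auto simp: C_diff_on_Suc_dird\<close>)
  then show ?case using d by (auto simp: C_diff_on_Suc_dird)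
qed

lemma C_diff_on_mult:
  assumes "open U" "C_diff_on m U F" "C_diff_on m U G"
  shows "C_diff_on m U (\<lambda>x. F x * G x)"
  using assms(2,3)
proof (induction m arbitrary: F G)
  case 0
  then show ?case by (auto intro!: continuous_intros)
next
  case (Suc m)
  have d: "F differentiable (at x)" "G differentiable (at x)" if "x \<in> U" for x
    using Suc.prems that by (auto simp: C_diff_on_Suc_dird)
  have e: "F x * dird v G x + dird v F x * G x = dird v (\<lambda>x. F x * G x) x" if "x \<in> U" for x v
    by (rule dird_eqI[symmetric]) (intro has_derivative_mult has_derivative_dird d that)
  have "C_diff_on m U (dird v (\<lambda>x. F x * G x))" for v
    by (rule C_diff_on_cong[OF assms(1) e], assumption, intro C_diff_on_add[OF assms(1)] Suc.IH)
       (use Suc.prems C_diff_on_SucD in \<open>auto simp: C_diff_on_Suc_dird\<close>)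
  then show ?case using d by (auto simp: C_diff_on_Suc_dird intro!: derivative_intros)
qed

lemma C_diff_on_sum:
  assumes "open U" "\<And>i. i \<in> I \<Longrightarrow> C_diff_on m U (F i)"
  shows "C_diff_on m U (\<lambda>x. \<Sum>i\<in>I. F i x)"
  using assms(2)
  by (induction I rule: infinite_finite_induct)
     (auto simp: C_diff_on_const intro!: C_diff_on_add assms(1))

text \<open>
  By the chain rule, a derivative of the composition is a sum of products of first derivatives of the
  components of \<open>g\<close> with partial derivatives of \<open>F\<close> composed with \<open>g\<close>. The latter are one degree less
  smooth and fall under the induction hypothesis.
\<close>

lemma C_diff_on_compose:
  fixes g :: "'a::euclidean_space \<Rightarrow> 'b::euclidean_space"
  assumes "open V" "g ` V \<subseteq> U"
  shows "C_diff_on m U F \<Longrightarrow> (\<And>b. b \<in> Basis \<Longrightarrow> C_diff_on m V (\<lambda>x. inner (g x) b))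
    \<Longrightarrow> C_diff_on m V (\<lambda>x. F (g x))"
proof (induction m arbitrary: F)
  case 0
  have "continuous_on V g"
    using 0(2) by (subst continuous_on_componentwise) auto
  then show ?case using 0(1) assms(2) continuous_on_compose2[of U F V g] by simp
next
  case (Suc m)
  have gb: "(\<lambda>x. inner (g x) b) differentiable (at x)" if "x \<in> V" "b \<in> Basis" for x b
    using Suc.prems(2) that by (auto simp: C_diff_on_Suc_dird)
  have gd: "(g has_derivative (\<lambda>v. \<Sum>b\<in>Basis. dird v (\<lambda>x. inner (g x) b) x *\<^sub>R b)) (at x)"
    if "x \<in> V" for x
  proof (subst has_derivative_componentwise_within, rule ballI)
    fix b :: 'b assume b: "b \<in> Basis"
    show "((\<lambda>x. inner (g x) b) has_derivative
       (\<lambda>v. inner (\<Sum>b\<in>Basis. dird v (\<lambda>x. inner (g x) b) x *\<^sub>R b) b)) (at x)"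
      using has_derivative_dird[OF gb[OF that b]] b
      by (simp add: inner_sum_left_Basis)
  qed
  have Fd: "(F has_derivative (\<lambda>v. dird v F (g x))) (at (g x))" if "x \<in> V" for x
    using Suc.prems(1) that assms(2) by (intro has_derivative_dird) (auto simp: C_diff_on_Suc_dird)
  have comp: "((\<lambda>x. F (g x)) has_derivative
      (\<lambda>v. \<Sum>b\<in>Basis. dird v (\<lambda>x. inner (g x) b) x * dird b F (g x))) (at x)" if "x \<in> V" for x
  proof -
    have lin: "linear (\<lambda>v. dird v F (g x))"
      using Fd[OF that] has_derivative_linear by blast
    show ?thesis
      using has_derivative_compose[OF gd[OF that] Fd[OF that]]
      by (simp add: linear_sum[OF lin] linear_scale[OF lin])
  qed
  have "C_diff_on m V (dird v (\<lambda>x. F (g x)))" for v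
  proof (rule C_diff_on_cong[OF assms(1)])
    show "(\<Sum>b\<in>Basis. dird v (\<lambda>x. inner (g x) b) x * dird b F (g x)) = dird v (\<lambda>x. F (g x)) x"
      if "x \<in> V" for x
      by (rule dird_eqI[symmetric, OF comp[OF that]])
    have "C_diff_on m V (\<lambda>x. dird b F (g x))" for b
    proof (rule Suc.IH)
      show "C_diff_on m U (dird b F)" using Suc.prems(1) by (simp add: C_diff_on_Suc_dird)
    qed (use Suc.prems(2) C_diff_on_SucD in blast)
    then show "C_diff_on m V (\<lambda>x. \<Sum>b\<in>Basis. dird v (\<lambda>x. inner (g x) b) x * dird b F (g x))"
      using Suc.prems(2) by (intro C_diff_on_sum C_diff_on_mult assms(1)) (auto simp: C_diff_on_Suc_dird)
  qed
  moreover have "(\<lambda>x. F (g x)) differentiable (at x)" if "x \<in> V" for x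
    using comp[OF that] unfolding differentiable_def by blast
  ultimately show ?case by (auto simp: C_diff_on_Suc_dird)
qed

text \<open>
  The exponent \<open>a\<close> is arbitrary because differentiation lowers it by one; the cases \<open>a = 1/2\<close> and
  \<open>a = -1/2\<close> are the norm and its reciprocal.
\<close>

lemma C_diff_on_norm_powr: "C_diff_on m (- {0}) (\<lambda>x::'a::euclidean_space. (inner x x) powr a)"
proof (induction m arbitrary: a)
  case 0
  show ?case by (auto intro!: continuous_intros)
next
  case (Suc m)
  have D: "((\<lambda>x. (inner x x) powr a) has_derivative
      (\<lambda>v. (2 * a) * ((inner x x) powr (a - 1) * inner x v))) (at x)" if "x \<in> - {0}" for x :: 'a
  proof -
    have "inner x x > 0" using that by simp
    then show ?thesis
      by (auto intro!: derivative_eq_intros simp: powr_diff inner_commute field_simps)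
  qed
  have "C_diff_on m (- {0}) (dird v (\<lambda>x::'a. (inner x x) powr a))" for v
  proof (rule C_diff_on_cong)
    show "(2 * a) * ((inner x x) powr (a - 1) * inner x v) = dird v (\<lambda>x::'a. (inner x x) powr a) x"
      if "x \<in> - {0}" for x :: 'a
      by (rule dird_eqI[symmetric, OF D[OF that]])
    show "C_diff_on m (- {0}) (\<lambda>x::'a. (2 * a) * ((inner x x) powr (a - 1) * inner x v))"
      by (intro C_diff_on_mult C_diff_on_const Suc C_diff_on_inner) auto
  qed auto
  then show ?case using D by (auto simp: C_diff_on_Suc_dird differentiable_def)
qed

lemma smooth_on_dird: "smooth_on U F \<Longrightarrow> smooth_on U (dird v F)"
  unfolding smooth_on_def using C_diff_on_Suc_dird by blast

lemma smooth_on_differentiable: "smooth_on U F \<Longrightarrow> x \<in> U \<Longrightarrow> F differentiable (at x)"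
  unfolding smooth_on_def using C_diff_on_Suc_dird by blast

lemma smooth_on_has_derivative:
  "smooth_on U F \<Longrightarrow> x \<in> U \<Longrightarrow> (F has_derivative (\<lambda>v. dird v F x)) (at x)"
  by (intro has_derivative_dird smooth_on_differentiable)

lemma smooth_on_continuous: "smooth_on U F \<Longrightarrow> continuous_on U F"
  unfolding smooth_on_def using C_diff_on.simps(1) by blast

lemma smooth_on_linear_dird: "smooth_on U F \<Longrightarrow> x \<in> U \<Longrightarrow> linear (\<lambda>v. dird v F x)"
  using smooth_on_has_derivative has_derivative_linear by blast

lemma smooth_on_DERIV_line:
  assumes "smooth_on U F" "x + s *\<^sub>R u \<in> U"
  shows "((\<lambda>s. F (x + s *\<^sub>R u)) has_real_derivative dird u F (x + s *\<^sub>R u)) (at s)"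
proof -
  have l: "linear (\<lambda>v. dird v F (x + s *\<^sub>R u))" using smooth_on_linear_dird assms by blast
  have "((\<lambda>s. x + s *\<^sub>R u) has_derivative (\<lambda>r. r *\<^sub>R u)) (at s)"
    by (auto intro!: derivative_eq_intros)
  from has_derivative_compose[OF this smooth_on_has_derivative[OF assms]]
  show ?thesis unfolding has_field_derivative_def
    by (rule has_derivative_eq_rhs) (auto simp: linear_scale[OF l])
qed

text \<open>
  The mean value theorem is applied twice, to the increment along \<open>v\<close> as a function of the step along
  \<open>u\<close> and then to \<open>dird u F\<close> along \<open>v\<close>. The left-hand side is symmetric in \<open>u\<close> and \<open>v\<close>; this is what
  makes mixed derivatives commute.
\<close>

lemma dird_second_difference:
  assumes F: "smooth_on U F" and sub: "ball x r \<subseteq> U" and t: "0 < t" "t * (norm u + norm v) < r"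
  shows "\<exists>a b. 0 < a \<and> a < t \<and> 0 < b \<and> b < t \<and>
    F (x + t *\<^sub>R u + t *\<^sub>R v) - F (x + t *\<^sub>R u) - F (x + t *\<^sub>R v) + F x
      = t * t * dird v (dird u F) (x + a *\<^sub>R u + b *\<^sub>R v)"
proof -
  have inU: "x + a *\<^sub>R u + b *\<^sub>R v \<in> U" if "0 \<le> a" "a \<le> t" "0 \<le> b" "b \<le> t" for a b
  proof -
    have "norm (a *\<^sub>R u + b *\<^sub>R v) \<le> a * norm u + b * norm v"
      using norm_triangle_ineq[of "a *\<^sub>R u" "b *\<^sub>R v"] that by simp
    also have "\<dots> \<le> t * norm u + t * norm v" using that by (intro add_mono mult_right_mono) auto
    also have "\<dots> < r" using t(2) by (simp add: algebra_simps)
    finally have "x + (a *\<^sub>R u + b *\<^sub>R v) \<in> ball x r" by (simp only: mem_ball dist_norm) (metis add_diff_cancel_left' norm_minus_commute)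
    then show ?thesis using sub by (auto simp: add.assoc)
  qed
  have d1: "((\<lambda>s. F (x + t *\<^sub>R v + s *\<^sub>R u) - F (x + s *\<^sub>R u)) has_real_derivative
      dird u F (x + t *\<^sub>R v + s *\<^sub>R u) - dird u F (x + s *\<^sub>R u)) (at s)" if "0 \<le> s" "s \<le> t" for s
    using inU[of s t] inU[of s 0] that t
    by (intro DERIV_diff smooth_on_DERIV_line[OF F]) (auto simp: algebra_simps)
  obtain a where a: "0 < a" "a < t" and ea:
    "F (x + t *\<^sub>R v + t *\<^sub>R u) - F (x + t *\<^sub>R u) - (F (x + t *\<^sub>R v + 0 *\<^sub>R u) - F (x + 0 *\<^sub>R u))
      = (t - 0) * (dird u F (x + t *\<^sub>R v + a *\<^sub>R u) - dird u F (x + a *\<^sub>R u))"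
    using MVT2[OF t(1) d1] by blast
  have d2: "((\<lambda>s. dird u F (x + a *\<^sub>R u + s *\<^sub>R v)) has_real_derivative
      dird v (dird u F) (x + a *\<^sub>R u + s *\<^sub>R v)) (at s)" if "0 \<le> s" "s \<le> t" for s
    using inU[of a s] that a by (intro smooth_on_DERIV_line[OF smooth_on_dird[OF F]]) auto
  obtain b where b: "0 < b" "b < t" and eb:
    "dird u F (x + a *\<^sub>R u + t *\<^sub>R v) - dird u F (x + a *\<^sub>R u + 0 *\<^sub>R v)
      = (t - 0) * dird v (dird u F) (x + a *\<^sub>R u + b *\<^sub>R v)"
    using MVT2[OF t(1) d2] by blast
  show ?thesis
    using a b ea eb by (intro exI[of _ a] exI[of _ b]) (simp add: algebra_simps)
qed

lemma dird_commute:
  assumes F: "smooth_on U F" and U: "open U" "x \<in> U"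
  shows "dird u (dird v F) x = dird v (dird u F) x"
proof (rule ccontr)
  let ?P = "dird v (dird u F)" and ?Q = "dird u (dird v F)"
  assume ne: "?Q x \<noteq> ?P x"
  define e where "e = \<bar>?Q x - ?P x\<bar> / 2"
  have e: "e > 0" using ne by (simp add: e_def)
  obtain r where r: "r > 0" "ball x r \<subseteq> U" using U openE by blast
  have "continuous (at x) ?P" "continuous (at x) ?Q"
    using F U smooth_on_dird smooth_on_continuous continuous_on_eq_continuous_at by blast+
  then obtain r1 r2 where
    r1: "r1 > 0" "\<And>y. dist y x < r1 \<Longrightarrow> dist (?P y) (?P x) < e" and
    r2: "r2 > 0" "\<And>y. dist y x < r2 \<Longrightarrow> dist (?Q y) (?Q x) < e"
    using e unfolding continuous_at_eps_delta by metis
  define m where "m = min r (min r1 r2)"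
  define t where "t = m / (norm u + norm v + 1) / 2"
  have m: "m > 0" using r r1 r2 by (simp add: m_def)
  have nn: "norm u + norm v + 1 > 0" by (smt (verit) norm_ge_zero)
  have t0: "t > 0" using m nn by (simp add: t_def)
  have "t * (norm u + norm v + 1) = m / 2" using nn unfolding t_def by (simp add: divide_simps)
  then have "t * (norm u + norm v) + t = m / 2" by (simp add: algebra_simps)
  then have t: "t * (norm u + norm v) < m" using t0 m by linarith
  then have t': "t * (norm u + norm v) < r" "t * (norm v + norm u) < r"
    by (auto simp: m_def add.commute)
  obtain a b where ab: "0 < a" "a < t" "0 < b" "b < t" and eab:
    "F (x + t *\<^sub>R u + t *\<^sub>R v) - F (x + t *\<^sub>R u) - F (x + t *\<^sub>R v) + F x
      = t * t * ?P (x + a *\<^sub>R u + b *\<^sub>R v)"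
    using dird_second_difference[OF F r(2) t0 t'(1)] by blast
  obtain c d where cd: "0 < c" "c < t" "0 < d" "d < t" and ecd:
    "F (x + t *\<^sub>R v + t *\<^sub>R u) - F (x + t *\<^sub>R v) - F (x + t *\<^sub>R u) + F x
      = t * t * ?Q (x + c *\<^sub>R v + d *\<^sub>R u)"
    using dird_second_difference[OF F r(2) t0 t'(2)] by blast
  have near: "dist (x + a *\<^sub>R u + b *\<^sub>R v) x < m" if "0 < a" "a < t" "0 < b" "b < t" for a b
  proof -
    have "norm (a *\<^sub>R u + b *\<^sub>R v) \<le> a * norm u + b * norm v"
      using norm_triangle_ineq[of "a *\<^sub>R u" "b *\<^sub>R v"] that by simp
    also have "\<dots> \<le> t * norm u + t * norm v" using that by (intro add_mono mult_right_mono) auto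
    also have "\<dots> < m" using t by (simp add: algebra_simps)
    finally show ?thesis by (simp add: dist_norm add.assoc)
  qed
  have "?P (x + a *\<^sub>R u + b *\<^sub>R v) = ?Q (x + c *\<^sub>R v + d *\<^sub>R u)"
    using eab ecd t0 by (simp add: algebra_simps)
  moreover have "dist (?P (x + a *\<^sub>R u + b *\<^sub>R v)) (?P x) < e"
    using near[OF ab] by (intro r1) (simp add: m_def)
  moreover have "dist (?Q (x + c *\<^sub>R v + d *\<^sub>R u)) (?Q x) < e"
    using near[of d c] cd by (intro r2) (simp add: m_def add.assoc add.commute[of "d *\<^sub>R u"])
  ultimately show False unfolding e_def dist_real_def by (simp add: abs_if split: if_splits)
qed

section \<open>Ordered principal frames and monotonicity of eigenvalues\<close>

text \<open>
  A minimizer of the Rayleigh quotient on the unit sphere of \<open>T\<close> is an eigenvector of the form. The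
  orthogonality statement is its first-order condition, obtained by perturbing \<open>v\<close> to \<open>v + t u\<close> with the
  step \<open>t\<close> for which the quadratic polynomial in \<open>t\<close> would become negative.
\<close>

lemma rayleigh_minimizer:
  fixes B :: "'a::euclidean_space \<Rightarrow> 'a \<Rightarrow> real"
  assumes bil: "bilinear B" and sym: "\<And>u v. B u v = B v u"
    and T: "subspace T" "T \<noteq> {0}"
  obtains v where "v \<in> T" "inner v v = 1" "\<And>u. u \<in> T \<Longrightarrow> B v v * inner u u \<le> B u u"
    "\<And>u. u \<in> T \<Longrightarrow> inner u v = 0 \<Longrightarrow> B u v = 0"
proof -
  interpret bb: bounded_bilinear B using bil by (simp add: bilinear_conv_bounded_bilinear)
  have ne: "T \<inter> sphere 0 1 \<noteq> {}"
  proof -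
    obtain z where z: "z \<in> T" "z \<noteq> 0" using T subspace_0 by blast
    then have "(1 / norm z) *\<^sub>R z \<in> T \<inter> sphere 0 1" using T(1) by (auto intro: subspace_scale)
    then show ?thesis by blast
  qed
  have "compact (T \<inter> sphere 0 1)"
    by (simp add: T(1) closed_Int_compact closed_subspace)
  moreover have "continuous_on (T \<inter> sphere 0 1) (\<lambda>v. B v v)"
    by (intro bb.continuous_on continuous_on_id)
  ultimately obtain v where v: "v \<in> T \<inter> sphere 0 1" "\<forall>u\<in>T \<inter> sphere 0 1. B v v \<le> B u u"
    using continuous_attains_inf[OF _ ne] by blast
  have vv: "inner v v = 1" using v(1) by (simp add: dot_square_norm)
  have min: "B v v * inner u u \<le> B u u" if "u \<in> T" for u
  proof (cases "u = 0")
    case True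
    then show ?thesis by (simp add: bb.zero_left)
  next
    case False
    then have "(1 / norm u) *\<^sub>R u \<in> T \<inter> sphere 0 1" using T(1) that by (auto intro: subspace_scale)
    then have "B v v \<le> B ((1 / norm u) *\<^sub>R u) ((1 / norm u) *\<^sub>R u)" using v(2) by blast
    also have "\<dots> = B u u / inner u u"
      by (simp add: bb.scaleR_left bb.scaleR_right dot_square_norm power2_eq_square)
    finally show ?thesis using False by (simp add: field_simps)
  qed
  have "B u v = 0" if u: "u \<in> T" "inner u v = 0" for u
  proof (rule ccontr)
    assume ne: "B u v \<noteq> 0"
    \<comment> \<open>The summand \<open>1\<close> keeps \<open>c\<close> positive; \<open>t\<close> minimizes \<open>2 t B u v + t\<^sup>2 c\<close>.\<close>
    define c where "c = \<bar>B u u - B v v * inner u u\<bar> + 1"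
    define t where "t = - B u v / c"
    have c: "c > 0" by (simp add: c_def)
    have "v + t *\<^sub>R u \<in> T" using u v T(1) by (auto intro: subspace_add subspace_scale)
    from min[OF this] have "0 \<le> 2 * t * B u v + t * t * (B u u - B v v * inner u u)"
      using vv u(2) sym[of v u]
      by (simp add: bb.add_left bb.add_right bb.scaleR_left bb.scaleR_right inner_add_left
          inner_add_right inner_commute[of v u] algebra_simps)
    also have "t * t * (B u u - B v v * inner u u) \<le> t * t * c"
      unfolding c_def by (intro mult_left_mono) auto
    also have "2 * t * B u v + t * t * c = - (B u v * B u v / c)"
      using c unfolding t_def by (simp add: field_simps)
    finally have "B u v * B u v / c \<le> 0" by simp
    moreover have "B u v * B u v / c > 0"
      using ne c by (intro divide_pos_pos) (auto simp: zero_less_mult_iff)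
    ultimately show False by linarith
  qed
  then show thesis using that v(1) vv min by blast
qed

text \<open>
  Splitting off a Rayleigh minimizer and recursing on its orthogonal complement in \<open>T\<close> produces the
  eigenvalues in increasing order, because each minimum is taken over a smaller space.
\<close>

lemma ordered_spectral_basis:
  fixes B :: "'a::euclidean_space \<Rightarrow> 'a \<Rightarrow> real"
  assumes bil: "bilinear B" and sym: "\<And>u v. B u v = B v u"
  shows "subspace T \<Longrightarrow> dim T = n \<Longrightarrow> \<exists>e.
    (\<forall>i<n. e i \<in> T) \<and>
    (\<forall>i<n. \<forall>j<n. inner (e i) (e j) = (if i = j then 1 else 0)) \<and>
    (\<forall>i<n. \<forall>j<n. i \<noteq> j \<longrightarrow> B (e i) (e j) = 0) \<and>
    (\<forall>i j. i \<le> j \<longrightarrow> j < n \<longrightarrow> B (e i) (e i) \<le> B (e j) (e j))"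
proof (induction n arbitrary: T)
  case 0
  then show ?case by simp
next
  case (Suc n)
  have "T \<noteq> {0}" using Suc.prems(2) by auto
  then obtain v where v: "v \<in> T" "inner v v = 1" and
    min: "\<And>u. u \<in> T \<Longrightarrow> B v v * inner u u \<le> B u u" and
    orth: "\<And>u. u \<in> T \<Longrightarrow> inner u v = 0 \<Longrightarrow> B u v = 0"
    using rayleigh_minimizer[OF bil sym Suc.prems(1)] by metis
  define T' where "T' = {y \<in> T. \<forall>x \<in> span {v}. Linear_Algebra.orthogonal x y}"
  have spv: "span {v} \<subseteq> T" using v(1) Suc.prems(1) by (simp add: span_minimal)
  have "v \<noteq> 0" using v(2) by auto
  have "dim T' + dim (span {v}) = dim T"
    unfolding T'_def by (rule dim_subspace_orthogonal_to_vectors) (use spv Suc.prems in auto)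
  then have dT': "dim T' = n"
    using Suc.prems(2) \<open>v \<noteq> 0\<close> by (simp add: dim_span)
  have T'_eq: "T' = T \<inter> {y. inner v y = 0}"
    unfolding T'_def by (auto simp: Linear_Algebra.orthogonal_def span_singleton)
  have sT': "subspace T'"
    unfolding T'_eq using Suc.prems(1) subspace_hyperplane subspace_inter by blast
  obtain e where e: "\<forall>i<n. e i \<in> T'"
    "\<forall>i<n. \<forall>j<n. inner (e i) (e j) = (if i = j then 1 else 0)"
    "\<forall>i<n. \<forall>j<n. i \<noteq> j \<longrightarrow> B (e i) (e j) = 0"
    "\<forall>i j. i \<le> j \<longrightarrow> j < n \<longrightarrow> B (e i) (e i) \<le> B (e j) (e j)"
    using Suc.IH[OF sT' dT'] by - (elim exE conjE, rule that)
  have eT: "e i \<in> T" "inner v (e i) = 0" "inner (e i) v = 0" "B (e i) v = 0" "B v (e i) = 0"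
    "B v v \<le> B (e i) (e i)" if "i < n" for i
  proof -
    show *: "e i \<in> T" "inner v (e i) = 0" using e(1) that T'_eq by auto
    then show "inner (e i) v = 0" by (simp add: inner_commute)
    then show "B (e i) v = 0" using orth * by blast
    then show "B v (e i) = 0" using sym by simp
    show "B v v \<le> B (e i) (e i)" using min[OF *(1)] e(2) that by simp
  qed
  show ?case
  proof (intro exI[of _ "case_nat v e"] conjI allI impI)
    fix i j :: nat
    assume "i < Suc n"
    then show "case_nat v e i \<in> T" using v(1) eT(1) by (auto split: nat.splits)
    assume j: "j < Suc n"
    show "inner (case_nat v e i) (case_nat v e j) = (if i = j then 1 else 0)"
      using \<open>i < Suc n\<close> j v(2) e(2) eT(2,3) by (auto split: nat.splits)
    show "B (case_nat v e i) (case_nat v e j) = 0" if "i \<noteq> j"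
      using that \<open>i < Suc n\<close> j e(3) eT(4,5) by (auto split: nat.splits)
  next
    fix i j :: nat
    assume "i \<le> j" "j < Suc n"
    then show "B (case_nat v e i) (case_nat v e i) \<le> B (case_nat v e j) (case_nat v e j)"
      using e(4) eT(6) by (auto split: nat.splits)
  qed
qed

text \<open>
  The ordering makes \<open>i \<mapsto> B (e i) (e i)\<close> the increasing list of eigenvalues, so that the eigenvalues of
  two forms can be compared index by index.
\<close>

definition principal_frame :: "nat \<Rightarrow> 'a::euclidean_space \<Rightarrow> ('a \<Rightarrow> 'a \<Rightarrow> real) \<Rightarrow> (nat \<Rightarrow> 'a) \<Rightarrow> bool" where
  "principal_frame n x B e \<longleftrightarrow> tangent_frame n x e \<and>
    (\<forall>i<n. \<forall>j<n. i \<noteq> j \<longrightarrow> B (e i) (e j) = 0) \<and>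
    (\<forall>i j. i \<le> j \<longrightarrow> j < n \<longrightarrow> B (e i) (e i) \<le> B (e j) (e j))"

lemma principal_frame_exists:
  fixes B :: "'a::euclidean_space \<Rightarrow> 'a \<Rightarrow> real"
  assumes "bilinear B" "\<And>u v. B u v = B v u" "DIM('a) = n + 1" "x \<noteq> 0"
  obtains e where "principal_frame n x B e"
proof -
  have "dim {v. inner x v = 0} = n" using dim_hyperplane[OF assms(4)] assms(3) by simp
  from ordered_spectral_basis[OF assms(1,2) subspace_hyperplane this]
  obtain e where "\<forall>i<n. e i \<in> {v. inner x v = 0}"
    "\<forall>i<n. \<forall>j<n. inner (e i) (e j) = (if i = j then 1 else 0)"
    "\<forall>i<n. \<forall>j<n. i \<noteq> j \<longrightarrow> B (e i) (e j) = 0"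
    "\<forall>i j. i \<le> j \<longrightarrow> j < n \<longrightarrow> B (e i) (e i) \<le> B (e j) (e j)"
    by - (elim exE conjE, rule that)
  then show thesis
    by (intro that) (simp add: principal_frame_def tangent_frame_def inner_commute)
qed

lemma tangent_frame_expand:
  fixes x :: "'a::euclidean_space"
  assumes "DIM('a) = n + 1" "x \<noteq> 0" and e: "tangent_frame n x e" and v: "inner v x = 0"
  shows "v = (\<Sum>j<n. inner v (e j) *\<^sub>R e j)"
proof -
  define S where "S = insert x (e ` {..<n})"
  define r where "r = v - (\<Sum>j<n. inner v (e j) *\<^sub>R e j)"
  have ee: "inner (e i) (e j) = (if i = j then 1 else 0)" if "i < n" "j < n" for i j
    using e that by (auto simp: tangent_frame_def)
  have ex: "inner (e i) x = 0" if "i < n" for i using e that by (auto simp: tangent_frame_def)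
  have ex': "inner x (e i) = 0" if "i < n" for i using ex[OF that] by (simp add: inner_commute)
  have inj: "inj_on e {..<n}"
  proof (rule inj_onI)
    fix i j assume ij: "i \<in> {..<n}" "j \<in> {..<n}" "e i = e j"
    then have "inner (e i) (e j) = 1" using ee[of i i] by simp
    then show "i = j" using ee[of i j] ij by (auto split: if_splits)
  qed
  have "x \<notin> e ` {..<n}"
  proof
    assume "x \<in> e ` {..<n}"
    then obtain i where "i < n" "x = e i" by auto
    then have "inner x x = 0" using ex[of i] by simp
    then show False using assms(2) by simp
  qed
  then have card: "card S = n + 1" unfolding S_def using inj by (simp add: card_image)
  have "pairwise Linear_Algebra.orthogonal S"
    unfolding S_def pairwise_def Linear_Algebra.orthogonal_def
    using ee ex ex' by auto
  moreover have "0 \<notin> S"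
    unfolding S_def using ee assms(2) by force
  ultimately have ind: "independent S" by (rule pairwise_orthogonal_independent)
  have "dim S = DIM('a)" using ind card assms(1) by (simp add: dim_eq_card_independent)
  then have sp: "span S = UNIV" using dim_eq_full by blast
  have "inner r (e i) = 0" if "i < n" for i
  proof -
    have "inner (\<Sum>j<n. inner v (e j) *\<^sub>R e j) (e i) = (\<Sum>j<n. if j = i then inner v (e j) else 0)"
      unfolding inner_sum_left by (rule sum.cong) (use ee that in auto)
    then show ?thesis unfolding r_def using that by (simp add: inner_diff_left)
  qed
  moreover have "inner r x = 0"
    unfolding r_def using v ex by (simp add: inner_diff_left inner_sum_left)
  ultimately have "Linear_Algebra.orthogonal r y" if "y \<in> S" for y using that by (auto simp: S_def Linear_Algebra.orthogonal_def)
  then have "Linear_Algebra.orthogonal r r" using orthogonal_to_span[of r S r] sp by blast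
  then have "r = 0" by (simp add: Linear_Algebra.orthogonal_def)
  then show ?thesis by (simp add: r_def)
qed

lemma principal_frame_quadratic_form:
  fixes B :: "'a::euclidean_space \<Rightarrow> 'a \<Rightarrow> real"
  assumes bil: "bilinear B" and e: "principal_frame n x B e" and I: "I \<subseteq> {..<n}"
    and v: "v = (\<Sum>j\<in>I. c j *\<^sub>R e j)"
  shows "B v v = (\<Sum>j\<in>I. (c j)\<^sup>2 * B (e j) (e j))" "inner v v = (\<Sum>j\<in>I. (c j)\<^sup>2)"
proof -
  have fin: "finite I" using I finite_subset by blast
  have gen: "H v v = (\<Sum>j\<in>I. (c j)\<^sup>2 * H (e j) (e j))"
    if H: "bounded_bilinear H" and off: "\<forall>i<n. \<forall>j<n. i \<noteq> j \<longrightarrow> H (e i) (e j) = 0"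
    for H :: "'a \<Rightarrow> 'a \<Rightarrow> real"
  proof -
    interpret H: bounded_bilinear H by fact
    have "H v v = (\<Sum>i\<in>I. \<Sum>j\<in>I. c i * c j * H (e i) (e j))"
      unfolding v by (simp add: H.sum_left H.sum_right H.scaleR_left H.scaleR_right sum_distrib_left mult.assoc)
         (subst sum.swap, simp add: mult.left_commute)
    also have "\<dots> = (\<Sum>i\<in>I. \<Sum>j\<in>I. if i = j then c i * c i * H (e i) (e i) else 0)"
      using off I by (intro sum.cong refl) auto
    also have "\<dots> = (\<Sum>i\<in>I. (c i)\<^sup>2 * H (e i) (e i))"
      using fin by (simp add: power2_eq_square)
    finally show ?thesis .
  qed
  have tf: "tangent_frame n x e" using e by (simp add: principal_frame_def)
  show "B v v = (\<Sum>j\<in>I. (c j)\<^sup>2 * B (e j) (e j))"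
    using bil e by (intro gen) (auto simp: bilinear_conv_bounded_bilinear principal_frame_def)
  have "inner v v = (\<Sum>j\<in>I. (c j)\<^sup>2 * inner (e j) (e j))"
    using tf by (intro gen bounded_bilinear_inner) (auto simp: tangent_frame_def)
  also have "\<dots> = (\<Sum>j\<in>I. (c j)\<^sup>2)"
    using tf I by (intro sum.cong) (auto simp: tangent_frame_def)
  finally show "inner v v = (\<Sum>j\<in>I. (c j)\<^sup>2)" .
qed

text \<open>
  The vectors orthogonal to \<open>W\<close> form a subspace of codimension at most \<open>card W\<close>, which is too small a
  codimension to meet \<open>S\<close> only in zero.
\<close>

lemma exists_orthogonal_in_subspace:
  fixes S W :: "'a::euclidean_space set"
  assumes "subspace S" "finite W" "card W < dim S"
  obtains v where "v \<in> S" "v \<noteq> 0" "\<And>w. w \<in> W \<Longrightarrow> inner v w = 0"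
proof -
  define N where "N = {y \<in> UNIV. \<forall>x \<in> span W. Linear_Algebra.orthogonal x y}"
  have N: "subspace N" unfolding N_def by (auto simp: subspace_def Linear_Algebra.orthogonal_def inner_add_right)
  have "dim N + dim (span W) = dim (UNIV :: 'a set)"
    unfolding N_def by (rule dim_subspace_orthogonal_to_vectors) auto
  moreover have "dim (span W) \<le> card W" using assms(2) by (simp add: dim_le_card')
  moreover have "dim {x + y |x y. x \<in> N \<and> y \<in> S} + dim (N \<inter> S) = dim N + dim S"
    by (rule dim_sums_Int[OF N assms(1)])
  moreover have "dim {x + y |x y. x \<in> N \<and> y \<in> S} \<le> dim (UNIV :: 'a set)"
    by (rule dim_subset) simp
  ultimately have "dim (N \<inter> S) > 0" using assms(3) by linarith
  then have "\<not> N \<inter> S \<subseteq> {0}" by (metis dim_eq_0 less_irrefl)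
  then obtain v where "v \<in> N" "v \<in> S" "v \<noteq> 0" by blast
  moreover have "inner v w = 0" if "w \<in> W" for w
    using \<open>v \<in> N\<close> span_base[OF that] by (auto simp: N_def Linear_Algebra.orthogonal_def inner_commute)
  ultimately show thesis using that by blast
qed

text \<open>
  The minimax principle for two forms on different hyperplanes, related by a linear map \<open>P\<close>. The span of
  the eigenvectors of \<open>A\<close> with index at least \<open>i\<close> has dimension \<open>n - i\<close>, and requiring \<open>P v\<close> to lie in the
  span of the eigenvectors of \<open>C\<close> with index at most \<open>i\<close> imposes only \<open>n - i - 1\<close> linear conditions. A nonzero
  \<open>v\<close> satisfying all of them has Rayleigh quotient at least the \<open>i\<close>-th eigenvalue for \<open>A\<close>, while its image has
  Rayleigh quotient at most the \<open>i\<close>-th eigenvalue for \<open>C\<close>.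
\<close>

lemma eigenvalue_comparison:
  fixes A C :: "'a::euclidean_space \<Rightarrow> 'a \<Rightarrow> real"
  assumes dim: "DIM('a) = n + 1"
    and A: "bilinear A" "principal_frame n x A e"
    and C: "bilinear C" "principal_frame n x' C e'" "x' \<noteq> 0"
    and P: "linear P" "\<And>v. inner v x = 0 \<Longrightarrow> inner (P v) x' = 0"
    and Pn: "\<And>v. inner v x = 0 \<Longrightarrow> inner (P v) (P v) \<le> s * inner v v"
    and AC: "\<And>v. inner v x = 0 \<Longrightarrow> A v v \<le> a * C (P v) (P v)"
    and a: "0 \<le> a" and i: "i < n" and Cpos: "0 \<le> C (e' i) (e' i)"
  shows "A (e i) (e i) \<le> a * s * C (e' i) (e' i)"
proof -
  have te: "tangent_frame n x e" "tangent_frame n x' e'"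
    using A C by (auto simp: principal_frame_def)
  define S where "S = span (e ` {i..<n})"
  define W where "W = adjoint P ` e' ` {Suc i..<n}"
  have ee: "inner (e k) (e j) = (if k = j then 1 else 0)" if "k < n" "j < n" for k j
    using te(1) that by (auto simp: tangent_frame_def)
  have inj: "inj_on e {i..<n}"
  proof (rule inj_onI)
    fix k j assume ij: "k \<in> {i..<n}" "j \<in> {i..<n}" "e k = e j"
    then have "inner (e k) (e j) = 1" using ee[of k k] by simp
    then show "k = j" using ee[of k j] ij by (auto split: if_splits)
  qed
  have "independent (e ` {i..<n})"
  proof (rule pairwise_orthogonal_independent)
    show "pairwise Linear_Algebra.orthogonal (e ` {i..<n})"
      using ee by (auto simp: pairwise_def Linear_Algebra.orthogonal_def)
    show "0 \<notin> e ` {i..<n}"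
    proof
      assume "0 \<in> e ` {i..<n}"
      then obtain k where "k < n" "e k = 0" by force
      then show False using ee[of k k] by simp
    qed
  qed
  then have "dim S = n - i" unfolding S_def using inj by (simp add: dim_span dim_eq_card_independent card_image)
  moreover have "card W \<le> n - Suc i"
    unfolding W_def by (metis card_atLeastLessThan card_image_le finite_atLeastLessThan finite_imageI le_trans)
  ultimately have "card W < dim S" using i by linarith
  then obtain v where v: "v \<in> S" "v \<noteq> 0" "\<And>w. w \<in> W \<Longrightarrow> inner v w = 0"
    using exists_orthogonal_in_subspace[of S W] unfolding S_def W_def by blast
  have "v \<in> range (\<lambda>c. \<Sum>j\<in>{i..<n}. c j *\<^sub>R e j)"
  proof -
    obtain u where u: "v = (\<Sum>w\<in>e ` {i..<n}. u w *\<^sub>R w)"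
      using v(1) unfolding S_def by (subst (asm) span_finite) auto
    also have "\<dots> = (\<Sum>j\<in>{i..<n}. u (e j) *\<^sub>R e j)" using inj by (simp add: sum.reindex)
    finally show ?thesis by (intro range_eqI[of _ _ "\<lambda>j. u (e j)"])
  qed
  then obtain c where c: "v = (\<Sum>j\<in>{i..<n}. c j *\<^sub>R e j)" by blast
  have vx: "inner v x = 0"
    unfolding c using te(1) by (auto simp: inner_sum_left tangent_frame_def intro!: sum.neutral)
  have I: "{i..<n} \<subseteq> {..<n}" "{..i} \<subseteq> {..<n}" using i by auto
  have qA: "A v v = (\<Sum>j\<in>{i..<n}. (c j)\<^sup>2 * A (e j) (e j))" "inner v v = (\<Sum>j\<in>{i..<n}. (c j)\<^sup>2)"
    using principal_frame_quadratic_form[OF A I(1) c] by auto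
  have lowA: "A (e i) (e i) * inner v v \<le> A v v"
    unfolding qA sum_distrib_left using A(2)
    by (intro sum_mono) (auto simp: principal_frame_def mult.commute[of _ "_\<^sup>2"] intro!: mult_left_mono)
  define b where "b = (\<lambda>j. inner (P v) (e' j))"
  have b0: "b j = 0" if "j \<in> {..<n} - {..i}" for j
  proof -
    have "inner v (adjoint P (e' j)) = 0" using that by (intro v(3)) (auto simp: W_def)
    then show ?thesis using adjoint_works[OF P(1)] by (simp add: b_def)
  qed
  have "P v = (\<Sum>j<n. b j *\<^sub>R e' j)"
    unfolding b_def by (rule tangent_frame_expand[OF dim C(3) te(2) P(2)[OF vx]])
  also have "\<dots> = (\<Sum>j\<in>{..i}. b j *\<^sub>R e' j)"
    using i b0 by (intro sum.mono_neutral_right) auto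
  finally have Pv: "P v = (\<Sum>j\<in>{..i}. b j *\<^sub>R e' j)" .
  have qC: "C (P v) (P v) = (\<Sum>j\<in>{..i}. (b j)\<^sup>2 * C (e' j) (e' j))"
    "inner (P v) (P v) = (\<Sum>j\<in>{..i}. (b j)\<^sup>2)"
    using principal_frame_quadratic_form[OF C(1,2) I(2) Pv] by auto
  have upC: "C (P v) (P v) \<le> C (e' i) (e' i) * inner (P v) (P v)"
    unfolding qC sum_distrib_left using C(2) i
    by (intro sum_mono) (auto simp: principal_frame_def mult.commute[of _ "_\<^sup>2"] intro!: mult_left_mono)
  have "A (e i) (e i) * inner v v \<le> a * C (P v) (P v)" using lowA AC[OF vx] by linarith
  also have "\<dots> \<le> a * (C (e' i) (e' i) * inner (P v) (P v))" using upC a by (rule mult_left_mono)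
  also have "\<dots> \<le> a * (C (e' i) (e' i) * (s * inner v v))"
    using Pn[OF vx] Cpos a by (intro mult_left_mono)
  finally have "A (e i) (e i) * inner v v \<le> (a * s * C (e' i) (e' i)) * inner v v"
    by (simp add: algebra_simps)
  moreover have "inner v v > 0" using v(2) by simp
  ultimately show ?thesis by (simp add: mult_le_cancel_right)
qed

definition elem_sym :: "nat \<Rightarrow> nat \<Rightarrow> (nat \<Rightarrow> real) \<Rightarrow> real" where
  "elem_sym n k l = (\<Sum>J | J \<subseteq> {..<n} \<and> card J = k. \<Prod>i\<in>J. l i)"

text \<open>
  In a principal frame the matrix is diagonal, and since its diagonal is increasing it coincides with the
  sorted list of roots of the characteristic polynomial.
\<close>

lemma sigma_k_principal_frame:
  assumes "principal_frame n x B e"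
  shows "sigma_k k (frame_matrix n e B) = elem_sym n k (\<lambda>i. B (e i) (e i))"
proof -
  let ?A = "frame_matrix n e B" and ?l = "map (\<lambda>i. B (e i) (e i)) [0..<n]"
  have car: "?A \<in> carrier_mat n n" by (simp add: frame_matrix_def)
  have ut: "upper_triangular ?A"
    using assms by (intro upper_triangularI) (auto simp: frame_matrix_def principal_frame_def)
  have dg: "diag_mat ?A = ?l" by (auto simp: diag_mat_def frame_matrix_def intro!: map_cong)
  have "char_poly ?A = (\<Prod>a\<leftarrow>?l. [:- a, 1:])"
    using char_poly_upper_triangular[OF car ut] dg by simp
  moreover have "proots (\<Prod>a\<leftarrow>l. [:- a, 1:]) = mset l" for l :: "real list"
  proof (induction l)
    case (Cons a l)
    have "(\<Prod>a\<leftarrow>l. [:- a, 1:]) \<noteq> 0" by (auto simp: prod_list_zero_iff)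
    then show ?case using Cons by (simp add: proots_mult del: mult_pCons_left)
  qed simp
  ultimately have pr: "proots (char_poly ?A) = mset ?l" by (simp only:)
  have "sorted ?l"
    using assms by (auto simp: sorted_iff_nth_mono principal_frame_def)
  then have "eigenvalue_list ?A = ?l"
    unfolding eigenvalue_list_def pr by (simp only: sorted_list_of_multiset_mset sorted_sort_id)
  then have "sigma_k k ?A = (\<Sum>J | J \<subseteq> {..<n} \<and> card J = k. \<Prod>i\<in>J. ?l ! i)"
    unfolding sigma_k_def Let_def by simp
  also have "\<dots> = elem_sym n k (\<lambda>i. B (e i) (e i))"
    unfolding elem_sym_def by (intro sum.cong prod.cong refl) auto
  finally show ?thesis .
qed

lemma elem_sym_mono_scaled:
  assumes "\<And>i. i < n \<Longrightarrow> 0 \<le> l i" "\<And>i. i < n \<Longrightarrow> l i \<le> c * m i"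
  shows "elem_sym n k l \<le> c ^ k * elem_sym n k m"
  unfolding elem_sym_def sum_distrib_left
proof (rule sum_mono, clarify)
  fix J assume J: "J \<subseteq> {..<n}" "k = card J"
  have "(\<Prod>i\<in>J. l i) \<le> (\<Prod>i\<in>J. c * m i)" using assms J by (intro prod_mono) auto
  then show "(\<Prod>i\<in>J. l i) \<le> c ^ card J * (\<Prod>i\<in>J. m i)" by (simp add: prod.distrib)
qed

section \<open>The homogeneous extension of a function on the sphere\<close>

text \<open>
  Of all extensions to the punctured space, the one homogeneous of degree one is chosen because its Hessian
  annihilates the radial direction and restricts to \<open>\<nabla>\<^sup>2h + hI\<close> on the tangent space.
\<close>

definition hom_ext :: "('a::euclidean_space \<Rightarrow> real) \<Rightarrow> 'a \<Rightarrow> real" where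
  "hom_ext h y = norm y * h (y /\<^sub>R norm y)"

lemma hom_ext_sphere: "norm x = 1 \<Longrightarrow> hom_ext h x = h x"
  by (simp add: hom_ext_def)

lemma hom_ext_scale: "0 < c \<Longrightarrow> hom_ext h (c *\<^sub>R y) = c * hom_ext h y"
proof -
  assume c: "0 < c"
  then have "inverse c * inverse (norm y) * c = inverse (norm y)" by (simp add: field_simps)
  then show ?thesis using c by (simp add: hom_ext_def \<open>inverse c * inverse (norm y) * c = inverse (norm y)\<close>)
qed

lemma hom_ext_pos:
  assumes "\<forall>x\<in>sphere 0 1. h x > 0" "y \<noteq> 0"
  shows "hom_ext h y > 0"
  using assms by (simp add: hom_ext_def)

text \<open>
  Any smooth extension \<open>F\<close> of \<open>h\<close> to a neighbourhood of the sphere represents the homogeneous extension as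
  \<open>\<bar>y\<bar> F(y / \<bar>y\<bar>)\<close>, a product and composition of smooth functions.
\<close>

lemma smooth_on_hom_ext:
  fixes h :: "'a::euclidean_space \<Rightarrow> real"
  assumes "smooth_on_sphere h"
  shows "smooth_on (- {0}) (hom_ext h)"
proof -
  obtain U F where UF: "open U" "sphere 0 1 \<subseteq> U" "\<forall>m. C_diff_on m U F" "\<forall>x\<in>sphere 0 1. F x = h x"
    using assms unfolding smooth_on_sphere_def by blast
  define g :: "'a \<Rightarrow> 'a" where "g y = (inner y y) powr (- 1/2) *\<^sub>R y" for y
  have n1: "(inner y y) powr (1/2) = norm y" if "y \<noteq> 0" for y :: 'a
    using that by (simp add: powr_half_sqrt norm_eq_sqrt_inner)
  have g: "g y = y /\<^sub>R norm y" if "y \<noteq> 0" for y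
    using n1[OF that] by (simp add: g_def powr_minus)
  have gs: "g y \<in> sphere 0 1" if "y \<noteq> 0" for y using g[OF that] that by simp
  have "C_diff_on m (- {0}) (hom_ext h)" for m
  proof (rule C_diff_on_cong)
    show "(inner y y) powr (1/2) * F (g y) = hom_ext h y" if "y \<in> - {0}" for y
      using that n1 gs[of y] g[of y] UF(4) by (simp add: hom_ext_def)
    have "C_diff_on m (- {0}) (\<lambda>y. F (g y))"
    proof (rule C_diff_on_compose[where U = U])
      show "g ` (- {0}) \<subseteq> U" using gs UF(2) by blast
      show "C_diff_on m U F" using UF(3) by simp
      show "C_diff_on m (- {0}) (\<lambda>y. inner (g y) b)" for b
        unfolding g_def inner_scaleR_left
        by (intro C_diff_on_mult C_diff_on_norm_powr C_diff_on_inner) auto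
    qed auto
    then show "C_diff_on m (- {0}) (\<lambda>y. (inner y y) powr (1/2) * F (g y))"
      by (intro C_diff_on_mult C_diff_on_norm_powr) auto
  qed auto
  then show ?thesis by (simp add: smooth_on_def)
qed

lemma dird_cong:
  assumes "smooth_on U F" "open U" "\<And>y. y \<in> U \<Longrightarrow> F y = G y" "x \<in> U"
  shows "dird v F x = dird v G x"
  using has_derivative_transform_within_open[OF smooth_on_has_derivative[OF assms(1,4)] assms(2,4,3)]
    dird_eqI by metis

text \<open>
  Each derivative lowers the degree of homogeneity by one: both sides differentiate the homogeneity relation
  \<open>P (c y) = a P y\<close> with respect to \<open>y\<close>.
\<close>

lemma dird_homogeneous:
  assumes P: "smooth_on (- {0}) P" and hom: "\<And>y. y \<noteq> 0 \<Longrightarrow> P (c *\<^sub>R y) = a * P y"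
    and c: "0 < c" and y: "y \<noteq> 0"
  shows "c * dird v P (c *\<^sub>R y) = a * dird v P y"
proof -
  have lin: "linear (\<lambda>v. dird v P (c *\<^sub>R y))"
    using smooth_on_linear_dird[OF P, of "c *\<^sub>R y"] c y by simp
  have "((\<lambda>y. c *\<^sub>R y) has_derivative (\<lambda>v. c *\<^sub>R v)) (at y)"
    by (auto intro!: derivative_eq_intros)
  moreover have "(P has_derivative (\<lambda>v. dird v P (c *\<^sub>R y))) (at (c *\<^sub>R y))"
    using smooth_on_has_derivative[OF P] c y by simp
  ultimately have "((\<lambda>y. P (c *\<^sub>R y)) has_derivative (\<lambda>v. dird (c *\<^sub>R v) P (c *\<^sub>R y))) (at y)"
    by (rule has_derivative_compose)
  then have "((\<lambda>y. a * P y) has_derivative (\<lambda>v. dird (c *\<^sub>R v) P (c *\<^sub>R y))) (at y)"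
    by (rule has_derivative_transform_within_open[of _ _ _ _ "- {0}"]) (use y hom in auto)
  moreover have "((\<lambda>y. a * P y) has_derivative (\<lambda>v. a * dird v P y)) (at y)"
    using smooth_on_has_derivative[OF P, of y] y by (intro has_derivative_mult_right) auto
  ultimately have "(\<lambda>v. dird (c *\<^sub>R v) P (c *\<^sub>R y)) = (\<lambda>v. a * dird v P y)"
    by (rule has_derivative_unique)
  then show ?thesis using linear_scale[OF lin] by (metis real_scaleR_def)
qed

lemma euler_homogeneous:
  assumes P: "smooth_on (- {0}) P" and hom: "\<And>c. 0 < c \<Longrightarrow> P (c *\<^sub>R y) = a c * P y"
    and a: "(a has_real_derivative a') (at 1)" and y: "y \<noteq> 0"
  shows "dird y P y = a' * P y"
proof -
  have "((\<lambda>s. P (0 + s *\<^sub>R y)) has_real_derivative dird y P (0 + 1 *\<^sub>R y)) (at 1)"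
    by (rule smooth_on_DERIV_line[OF P]) (use y in simp)
  then have "((\<lambda>s. P (s *\<^sub>R y)) has_real_derivative dird y P y) (at 1)" by simp
  moreover have "((\<lambda>s. P (s *\<^sub>R y)) has_real_derivative a' * P y) (at 1)"
    using DERIV_cmult_right[OF a, of "P y"]
    by (rule has_field_derivative_transform_within_open[of _ _ _ "{0<..}"]) (auto simp: hom)
  ultimately show ?thesis by (rule DERIV_unique)
qed

definition egrad :: "('a::euclidean_space \<Rightarrow> real) \<Rightarrow> 'a \<Rightarrow> 'a" where
  "egrad P y = (\<Sum>b\<in>Basis. dird b P y *\<^sub>R b)"

lemma inner_egrad:
  assumes "smooth_on U P" "y \<in> U"
  shows "inner (egrad P y) v = dird v P y"
proof -
  note lin = smooth_on_linear_dird[OF assms]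
  have "dird v P y = dird (\<Sum>b\<in>Basis. inner v b *\<^sub>R b) P y" by (simp add: euclidean_representation)
  also have "\<dots> = (\<Sum>b\<in>Basis. inner v b * dird b P y)"
    by (simp add: linear_sum[OF lin] linear_scale[OF lin])
  finally show ?thesis by (simp add: egrad_def inner_sum_left inner_commute[of v] mult.commute)
qed

lemma norm_egrad: "(norm (egrad P y))\<^sup>2 = (\<Sum>b\<in>Basis. (dird b P y)\<^sup>2)"
  unfolding egrad_def power2_norm_eq_inner by (subst euclidean_inner) (simp add: inner_sum_left_Basis power2_eq_square)

lemma egrad_has_derivative:
  assumes "smooth_on U P" "y \<in> U"
  shows "(egrad P has_derivative (\<lambda>v. \<Sum>b\<in>Basis. dird v (dird b P) y *\<^sub>R b)) (at y)"
  unfolding egrad_def[abs_def]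
  by (intro has_derivative_sum has_derivative_scaleR_left smooth_on_has_derivative[OF smooth_on_dird[OF assms(1)] assms(2)])

text \<open>
  A derivative within the sphere is tested against the curve \<open>t \<mapsto> (x + t u) / \<bar>x + t u\<bar>\<close>, which stays on the
  sphere and leaves \<open>x\<close> with velocity \<open>u\<close>. This makes the gradient and the covariant derivative, which are
  defined through derivatives within the sphere, computable from any smooth extension.
\<close>

lemma sphere_tangent_derivative_unique:
  fixes f :: "'a::euclidean_space \<Rightarrow> 'b::real_normed_vector"
  assumes f: "(f has_derivative f1) (at x within sphere 0 1)" "(f has_derivative f2) (at x within sphere 0 1)"
    and x: "norm x = 1" and u: "inner u x = 0"
  shows "f1 u = f2 u"
proof -
  define c where "c t = (x + t *\<^sub>R u) /\<^sub>R norm (x + t *\<^sub>R u)" for t :: real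
  have nn: "inner (x + t *\<^sub>R u) (x + t *\<^sub>R u) = 1 + t * t * inner u u" for t
    using x u by (simp add: inner_add_left inner_add_right inner_commute dot_square_norm[of x])
  have pos: "1 + t * t * inner u u > 0" for t by (simp add: add_pos_nonneg)
  have ne: "x + t *\<^sub>R u \<noteq> 0" for t using nn[of t] pos[of t] by auto
  have cs: "c t \<in> sphere 0 1" for t using ne[of t] by (simp add: c_def)
  have c0: "c 0 = x" using x by (simp add: c_def)
  have "((\<lambda>t. inverse (sqrt (1 + t * t * inner u u)) *\<^sub>R (x + t *\<^sub>R u)) has_derivative (\<lambda>t. t *\<^sub>R u)) (at 0)"
    by (auto intro!: derivative_eq_intros)
  moreover have "c = (\<lambda>t. inverse (sqrt (1 + t * t * inner u u)) *\<^sub>R (x + t *\<^sub>R u))"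
    by (auto simp: c_def fun_eq_iff norm_eq_sqrt_inner[of "_ + _"] nn)
  ultimately have dc: "(c has_derivative (\<lambda>t. t *\<^sub>R u)) (at 0)" by simp
  have "((\<lambda>t. f (c t)) has_derivative (\<lambda>t. f' (t *\<^sub>R u))) (at 0)"
    if "(f has_derivative f') (at x within sphere 0 1)" for f'
  proof -
    have "(f has_derivative f') (at (c 0) within range c)"
      unfolding c0 by (rule has_derivative_subset[OF that]) (use cs in blast)
    from has_derivative_in_compose[OF dc this] show ?thesis .
  qed
  from has_derivative_unique[OF this[OF f(1)] this[OF f(2)]]
  have "f1 (1 *\<^sub>R u) = f2 (1 *\<^sub>R u)" by metis
  then show ?thesis by simp
qed

lemma hom_ext_dird_self:
  assumes "smooth_on_sphere h" "y \<noteq> 0"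
  shows "dird y (hom_ext h) y = hom_ext h y"
proof -
  have "dird y (hom_ext h) y = 1 * hom_ext h y"
    by (rule euler_homogeneous[OF smooth_on_hom_ext[OF assms(1)], where a = "\<lambda>c. c"])
       (use assms(2) in \<open>simp_all add: hom_ext_scale\<close>)
  then show ?thesis by simp
qed

text \<open>
  On the sphere \<open>h\<close> agrees with \<open>hom_ext h y / \<bar>y\<bar>\<close>, the extension that is constant along rays; its
  ambient gradient is already tangent.
\<close>

lemma sphere_has_derivative:
  assumes h: "smooth_on_sphere h" and x: "norm x = 1"
  shows "(h has_derivative (\<lambda>v. inner (egrad (hom_ext h) x - h x *\<^sub>R x) v)) (at x within sphere 0 1)"
proof -
  have ne: "x \<noteq> 0" using x by auto
  note H = smooth_on_hom_ext[OF h]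
  have n: "(norm has_derivative (\<lambda>v. inner x v)) (at x)"
    using has_derivative_norm[OF ne] x by (simp add: sgn_div_norm inner_commute)
  have "((\<lambda>y. hom_ext h y / norm y) has_derivative
      (\<lambda>v. inner (egrad (hom_ext h) x - h x *\<^sub>R x) v)) (at x)"
    by (rule has_derivative_eq_rhs[OF has_derivative_divide'[OF smooth_on_has_derivative[OF H] n]])
       (use ne x in \<open>auto simp: inner_diff_left inner_egrad[OF H] hom_ext_sphere\<close>)
  then have "((\<lambda>y. hom_ext h y / norm y) has_derivative
      (\<lambda>v. inner (egrad (hom_ext h) x - h x *\<^sub>R x) v)) (at x within sphere 0 1)"
    by (rule has_derivative_at_withinI)
  then show ?thesis
    by (rule has_derivative_transform[rotated 2]) (use x in \<open>auto simp: hom_ext_sphere dot_square_norm\<close>)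
qed

lemma sphere_grad_eq:
  assumes h: "smooth_on_sphere h" and x: "norm x = 1"
  shows "sphere_grad h x = egrad (hom_ext h) x - h x *\<^sub>R x" "inner (sphere_grad h x) x = 0"
proof -
  let ?g = "egrad (hom_ext h) x - h x *\<^sub>R x"
  have ne: "x \<noteq> 0" using x by auto
  note H = smooth_on_hom_ext[OF h]
  have orth: "inner ?g x = 0"
    using inner_egrad[OF H, of x x] ne hom_ext_dird_self[OF h ne] x
    by (simp add: inner_diff_left hom_ext_sphere dot_square_norm)
  show eq: "sphere_grad h x = ?g"
    unfolding sphere_grad_def
  proof (rule the_equality)
    show "inner ?g x = 0 \<and> (h has_derivative (\<lambda>v. inner ?g v)) (at x within sphere 0 1)"
      using orth sphere_has_derivative[OF h x] by simp
  next
    fix g assume g: "inner g x = 0 \<and> (h has_derivative (\<lambda>v. inner g v)) (at x within sphere 0 1)"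
    have "inner (g - ?g) x = 0" using g orth by (simp add: inner_diff_left)
    then have "inner g (g - ?g) = inner ?g (g - ?g)"
      using sphere_tangent_derivative_unique[OF conjunct2[OF g] sphere_has_derivative[OF h x] x] by blast
    then have "inner (g - ?g) (g - ?g) = 0" by (simp only: inner_diff_left[of g])
    then show "g = ?g" by simp
  qed
  show "inner (sphere_grad h x) x = 0" using orth eq by simp
qed

lemma square_plus_norm_sphere_grad:
  assumes h: "smooth_on_sphere h" and x: "norm x = 1"
  shows "(h x)\<^sup>2 + (norm (sphere_grad h x))\<^sup>2 = (norm (egrad (hom_ext h) x))\<^sup>2"
proof -
  have "egrad (hom_ext h) x = sphere_grad h x + h x *\<^sub>R x" using sphere_grad_eq[OF assms] by simp
  then show ?thesis using sphere_grad_eq(2)[OF assms] x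
    unfolding power2_norm_eq_inner
    by (simp add: inner_add_left inner_add_right dot_square_norm[of x] power2_eq_square inner_commute[of x "sphere_grad h x"])
qed

text \<open>
  Differentiating \<open>\<nabla>h = DH - H x\<close> along a tangent vector \<open>u\<close> gives \<open>D\<^sup>2H u - h u\<close> up to a normal
  component, so adding \<open>h I\<close> leaves exactly \<open>D\<^sup>2H\<close>.
\<close>

lemma hess_plus_eq:
  assumes h: "smooth_on_sphere h" and x: "norm x = 1" and uv: "inner u x = 0" "inner v x = 0"
  shows "hess_plus h x u v = dird u (dird v (hom_ext h)) x"
proof -
  let ?H = "hom_ext h"
  note H = smooth_on_hom_ext[OF h]
  have ne: "x \<in> - {0}" using x by auto
  have dc: "dird u (dird v ?H) x = dird v (dird u ?H) x" for u v
    by (intro dird_commute[OF H _ ne]) auto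
  define D where "D v = (\<Sum>b\<in>Basis. dird v (dird b ?H) x *\<^sub>R b) - (?H x *\<^sub>R v + dird v ?H x *\<^sub>R x)" for v
  have "((\<lambda>y. egrad ?H y - ?H y *\<^sub>R y) has_derivative D) (at x within sphere 0 1)"
    unfolding D_def
    by (rule has_derivative_at_withinI, intro has_derivative_diff egrad_has_derivative[OF H ne]
        has_derivative_scaleR[OF smooth_on_has_derivative[OF H ne] has_derivative_ident])
  then have D: "(sphere_grad h has_derivative D) (at x within sphere 0 1)"
    by (rule has_derivative_transform[rotated 2]) (use x in \<open>auto simp: sphere_grad_eq[OF h] hom_ext_sphere\<close>)
  then have "sphere_grad h differentiable (at x within sphere 0 1)" by (auto simp: differentiable_def)
  then have "(sphere_grad h has_derivative frechet_derivative (sphere_grad h) (at x within sphere 0 1)) (at x within sphere 0 1)"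
    by (simp add: frechet_derivative_works)
  from sphere_tangent_derivative_unique[OF this D x uv(1)]
  have fr: "frechet_derivative (sphere_grad h) (at x within sphere 0 1) u = D u" .
  have "inner (\<Sum>b\<in>Basis. dird u (dird b ?H) x *\<^sub>R b) v = (\<Sum>b\<in>Basis. inner v b * dird b (dird u ?H) x)"
    using dc[of u] by (simp add: inner_sum_left inner_commute[of v] mult.commute)
  also have "\<dots> = dird v (dird u ?H) x"
    using inner_egrad[OF smooth_on_dird[OF H] ne, of u v]
    by (simp add: egrad_def inner_sum_left inner_commute[of v] mult.commute)
  also have "\<dots> = dird u (dird v ?H) x" by (rule dc)
  finally have "inner (D u) v = dird u (dird v ?H) x - h x * inner u v"
    using uv x by (simp add: D_def inner_diff_left inner_add_left hom_ext_sphere inner_commute[of x v])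
  then show ?thesis
    unfolding hess_plus_def sphere_hess_def sphere_cov_def tangent_proj_def fr
    using uv by (simp add: inner_diff_left inner_commute[of x v])
qed

lemma dird_dird_bilinear:
  assumes H: "smooth_on U H" "open U" "y \<in> U"
  shows "bilinear (\<lambda>u v. dird u (dird v H) y)" "dird u (dird v H) y = dird v (dird u H) y"
proof -
  show sym: "dird u (dird v H) y = dird v (dird u H) y" for u v using dird_commute[OF assms] .
  have l: "linear (\<lambda>u. dird u (dird v H) y)" for v
    by (rule smooth_on_linear_dird[OF smooth_on_dird[OF H(1)] H(3)])
  have "linear (\<lambda>v. dird u (dird v H) y)" for u using l[of u] sym by simp
  then show "bilinear (\<lambda>u v. dird u (dird v H) y)" using l by (simp add: bilinear_def)
qed

text \<open>This is the Codazzi equation, transferred to the homogeneous extension.\<close>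

lemma dird_third_commute:
  assumes H: "smooth_on U H" "open U" "y \<in> U"
  shows "dird u (dird u (dird v H)) y = dird v (dird u (dird u H)) y"
proof -
  have "dird u (dird u (dird v H)) y = dird u (dird v (dird u H)) y"
    by (rule dird_cong[OF _ H(2) _ H(3)])
       (auto intro: smooth_on_dird H dird_commute)
  also have "\<dots> = dird v (dird u (dird u H)) y"
    by (rule dird_commute[OF smooth_on_dird[OF H(1)] H(2,3)])
  finally show ?thesis .
qed

section \<open>The second-order condition at a maximum point\<close>

lemma second_derivative_test_max:
  fixes L :: "real \<Rightarrow> real"
  assumes L: "\<And>s. (L has_real_derivative L' s) (at s)" and L': "(L' has_real_derivative d) (at 0)"
    and max: "\<And>s. L s \<le> L 0"
  shows "L' 0 = 0" "d \<le> 0"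
proof -
  show z: "L' 0 = 0" using DERIV_local_max[OF L[of 0], of 1] max by auto
  show "d \<le> 0"
  proof (rule ccontr)
    assume "\<not> d \<le> 0"
    then obtain e where e: "e > 0" "\<forall>s>0. s < e \<longrightarrow> L' 0 < L' (0 + s)"
      using DERIV_pos_inc_right[OF L'] by auto
    obtain c where "0 < c" "c < e / 2" "L (e / 2) - L 0 = (e / 2 - 0) * L' c"
      using MVT2[of 0 "e / 2" L L'] L e(1) by auto
    moreover from this have "0 < (e / 2 - 0) * L' c" using e z by (intro mult_pos_pos) auto
    ultimately have "L (e / 2) > L 0" by linarith
    then show False using max[of "e / 2"] by simp
  qed
qed

lemma egrad_pos:
  assumes H: "smooth_on (- {0}) H" and hom: "\<And>c y. 0 < c \<Longrightarrow> H (c *\<^sub>R y) = c * H y"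
    and pos: "\<And>y. y \<noteq> 0 \<Longrightarrow> H y > 0" and y: "y \<noteq> 0"
  shows "dird y H y = H y" "(norm (egrad H y))\<^sup>2 > 0"
proof -
  have "dird y H y = 1 * H y"
    by (rule euler_homogeneous[OF H, where a = "\<lambda>c. c"]) (use y hom in auto)
  then show e: "dird y H y = H y" by simp
  then have "inner (egrad H y) y > 0" using inner_egrad[OF H, of y y] y pos by simp
  then show "(norm (egrad H y))\<^sup>2 > 0" by auto
qed

lemma homogeneous_dird:
  assumes H: "smooth_on (- {0}) H" and hom: "\<And>c y. 0 < c \<Longrightarrow> H (c *\<^sub>R y) = c * H y"
    and c: "0 < c" and y: "y \<noteq> 0"
  shows "dird v H (c *\<^sub>R y) = dird v H y"
    and "c * dird u (dird v H) (c *\<^sub>R y) = dird u (dird v H) y"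
    and "egrad H (c *\<^sub>R y) = egrad H y"
    and "dird y (dird v H) y = 0"
    and "dird y (dird u (dird v H)) y = - dird u (dird v H) y"
proof -
  have 1: "dird v H (c *\<^sub>R y) = dird v H y" if "0 < c" "y \<noteq> 0" for c y v
    using dird_homogeneous[OF H, of c c y v] hom that by simp
  have 2: "c * dird u (dird v H) (c *\<^sub>R y) = dird u (dird v H) y" if "0 < c" "y \<noteq> 0" for c y
    using dird_homogeneous[OF smooth_on_dird[OF H], of v c 1 y u] 1 that by simp
  show "dird v H (c *\<^sub>R y) = dird v H y" "c * dird u (dird v H) (c *\<^sub>R y) = dird u (dird v H) y"
    using 1 2 c y by auto
  show "egrad H (c *\<^sub>R y) = egrad H y" using 1 c y by (simp add: egrad_def)
  have "dird y (dird v H) y = 0 * dird v H y"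
    by (rule euler_homogeneous[OF smooth_on_dird[OF H], where a = "\<lambda>_. 1"]) (use 1 y in auto)
  then show "dird y (dird v H) y = 0" by simp
  have "dird y (dird u (dird v H)) y = (- 1) * dird u (dird v H) y"
  proof (rule euler_homogeneous[OF smooth_on_dird[OF smooth_on_dird[OF H]], where a = "\<lambda>c. inverse c"])
    show "dird u (dird v H) (c *\<^sub>R y) = inverse c * dird u (dird v H) y" if "0 < c" for c
      using 2[OF that y] that by (simp add: field_simps)
    show "(inverse has_real_derivative - 1) (at 1)" by (auto intro!: derivative_eq_intros)
  qed (use y in auto)
  then show "dird y (dird u (dird v H)) y = - dird u (dird v H) y" by simp
qed

lemma norm_egrad_DERIV_line:
  assumes H: "smooth_on U H" "x + s *\<^sub>R u \<in> U"
  shows "((\<lambda>s. (norm (egrad H (x + s *\<^sub>R u)))\<^sup>2) has_real_derivative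
    (\<Sum>b\<in>Basis. 2 * (dird b H (x + s *\<^sub>R u) * dird u (dird b H) (x + s *\<^sub>R u)))) (at s)"
  unfolding norm_egrad
  by (rule derivative_eq_intros smooth_on_DERIV_line[OF smooth_on_dird[OF H(1)] H(2)] refl)+
     (simp add: mult.commute)

text \<open>
  The radial part of \<open>egrad H x\<close> contributes nothing, because \<open>dird u H\<close> is homogeneous of degree zero.
\<close>

lemma norm_egrad_first_variation:
  assumes H: "smooth_on (- {0}) H" and hom: "\<And>c y. 0 < c \<Longrightarrow> H (c *\<^sub>R y) = c * H y"
    and x: "x \<noteq> 0" and w: "w = egrad H x - H x *\<^sub>R x"
  shows "(\<Sum>b\<in>Basis. 2 * (dird b H x * dird u (dird b H) x)) = 2 * dird w (dird u H) x"
proof -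
  have x0: "x \<in> - {0}" using x by simp
  have opn: "open (- {0::'a})" by auto
  have gx: "egrad H x = w + H x *\<^sub>R x" using w by simp
  have "(\<Sum>b\<in>Basis. 2 * (dird b H x * dird u (dird b H) x)) = 2 * (\<Sum>b\<in>Basis. dird b H x * dird b (dird u H) x)"
    unfolding sum_distrib_left
    by (intro sum.cong refl) (simp only: dird_commute[OF H opn x0, of u])
  also have "(\<Sum>b\<in>Basis. dird b H x * dird b (dird u H) x) = inner (egrad (dird u H) x) (egrad H x)"
    unfolding egrad_def by (simp add: inner_sum_right inner_sum_left_Basis)
  also have "\<dots> = dird w (dird u H) x"
    unfolding gx inner_add_right inner_scaleR_right inner_egrad[OF smooth_on_dird[OF H] x0]
    using homogeneous_dird(4)[OF H hom _ x, of 1 u] by simp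
  finally show ?thesis .
qed

text \<open>
  Here \<open>\<rho>\<close> is the squared norm of the gradient, \<open>m\<close> is \<open>B(w, u)\<close>, \<open>a\<close> is the inner product of \<open>w\<close> and \<open>u\<close>, \<open>S\<close>
  is \<open>\<bar>B u\<bar>\<^sup>2\<close>, \<open>T\<close> is the third derivative in the directions \<open>w, u, u\<close>, \<open>B\<close> stands for \<open>B(u, u)\<close> and \<open>U\<close> for
  \<open>\<bar>u\<bar>\<^sup>2\<close>. The assumptions \<open>first\<close> and \<open>second\<close> are the two derivative tests. The terms containing \<open>a\<^sup>2\<close> add up to a
  nonnegative multiple of \<open>\<gamma> - 2\<close> once \<open>S\<close> has been bounded below by the Cauchy-Schwarz inequality \<open>CS\<close>; this is where
  \<open>\<gamma> < 2\<close> enters.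
\<close>

lemma max_point_arithmetic:
  fixes \<gamma> \<rho> h a m S T B U :: real
  assumes g: "0 < \<gamma>" "\<gamma> < 2" and pos: "0 < \<rho>" "0 < h"
    and first: "2 * m / \<rho> - \<gamma> * (a / h) = 0"
    and second: "((2 * (S + T - h * B)) * \<rho> - (2 * m) * (2 * m)) / (\<rho> * \<rho>)
      - \<gamma> * ((B * h - a * a) / (h * h)) + \<gamma> * U \<le> 0"
    and CS: "m\<^sup>2 \<le> S * \<rho>"
  shows "2 * m * h = \<gamma> * \<rho> * a" "T + \<rho> * \<gamma> / 2 * U \<le> (h + \<gamma> * \<rho> / (2 * h)) * B"
proof -
  show f: "2 * m * h = \<gamma> * \<rho> * a" using first pos by (simp add: field_simps)
  define b where "b = a / h"
  have m: "m = \<gamma> * \<rho> * b / 2" using f pos by (simp add: b_def field_simps)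
  have S: "\<gamma>\<^sup>2 * \<rho> * b\<^sup>2 / 4 \<le> S"
  proof -
    have "(\<gamma>\<^sup>2 * \<rho> * b\<^sup>2 / 4) * \<rho> \<le> S * \<rho>" using CS unfolding m by (simp add: power2_eq_square algebra_simps)
    then show ?thesis using pos by (simp only: mult_le_cancel_right)
  qed
  have "((2 * (S + T - h * B)) * \<rho> - (2 * m) * (2 * m)) / (\<rho> * \<rho>) = 2 * (S + T - h * B) / \<rho> - \<gamma>\<^sup>2 * b\<^sup>2"
    unfolding m using pos by (simp add: field_simps power2_eq_square)
  moreover have "(B * h - a * a) / (h * h) = B / h - b\<^sup>2"
    using pos by (simp add: b_def field_simps power2_eq_square)
  ultimately have "2 * (S + T - h * B) / \<rho> \<le> \<gamma>\<^sup>2 * b\<^sup>2 + \<gamma> * (B / h - b\<^sup>2) - \<gamma> * U"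
    using second by simp
  then have "2 * (S + T - h * B) \<le> (\<gamma>\<^sup>2 * b\<^sup>2 + \<gamma> * (B / h - b\<^sup>2) - \<gamma> * U) * \<rho>"
    using pos by (simp add: pos_divide_le_eq)
  also have "\<dots> = \<gamma>\<^sup>2 * \<rho> * b\<^sup>2 + \<gamma> * \<rho> * (B / h) - \<gamma> * \<rho> * b\<^sup>2 - \<gamma> * \<rho> * U"
    by (simp add: algebra_simps)
  finally have upper: "2 * (S + T - h * B)
      \<le> \<gamma>\<^sup>2 * \<rho> * b\<^sup>2 + \<gamma> * \<rho> * (B / h) - \<gamma> * \<rho> * b\<^sup>2 - \<gamma> * \<rho> * U" .
  have "2 * (S + T - hB) \<le> X + Y - Z - W \<Longrightarrow> X / 4 \<le> S \<Longrightarrow>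
      2 * T \<le> 2 * hB + Y - W + (X - Z - 2 * (X / 4))" for X Y Z W hB :: real
    by (simp add: field_simps)
  from this[OF upper S] have "2 * T \<le> 2 * (h * B) + \<gamma> * \<rho> * (B / h) - \<gamma> * \<rho> * U
      + (\<gamma>\<^sup>2 * \<rho> * b\<^sup>2 - \<gamma> * \<rho> * b\<^sup>2 - 2 * (\<gamma>\<^sup>2 * \<rho> * b\<^sup>2 / 4))" .
  also have "\<gamma>\<^sup>2 * \<rho> * b\<^sup>2 - \<gamma> * \<rho> * b\<^sup>2 - 2 * (\<gamma>\<^sup>2 * \<rho> * b\<^sup>2 / 4) = - ((\<gamma> * \<rho> * b\<^sup>2) * (2 - \<gamma>) / 2)"
    by (simp add: power2_eq_square field_simps)
  also have "\<dots> \<le> 0" using g pos by (simp add: mult_nonneg_nonneg)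
  finally show "T + \<rho> * \<gamma> / 2 * U \<le> (h + \<gamma> * \<rho> / (2 * h)) * B"
    by (simp add: algebra_simps)
qed

text \<open>
  The derivative tests are applied along the straight line \<open>x + s u\<close> to the logarithm of the maximized
  quotient. Since \<open>N\<close> has degree zero and \<open>H\<close> degree one, evaluating the quotient at the radial projection
  of \<open>x + s u\<close> only adds the term \<open>\<gamma>/2 ln (1 + s\<^sup>2 \<bar>u\<bar>\<^sup>2)\<close>. The latter is also the source of the
  slack \<open>N x * \<gamma> / 2 * inner u u\<close>, which later absorbs the error in a first-order expansion.
\<close>

lemma max_point_hessian_bound:
  fixes H :: "'a::euclidean_space \<Rightarrow> real"
  defines "N \<equiv> \<lambda>y. (norm (egrad H y))\<^sup>2"
  assumes H: "smooth_on (- {0}) H" and hom: "\<And>c y. 0 < c \<Longrightarrow> H (c *\<^sub>R y) = c * H y"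
    and pos: "\<And>y. y \<noteq> 0 \<Longrightarrow> H y > 0" and x: "norm x = 1" and g: "0 < \<gamma>" "\<gamma> < 2"
    and max: "\<And>y. norm y = 1 \<Longrightarrow> N y / H y powr \<gamma> \<le> N x / H x powr \<gamma>"
    and u: "inner u x = 0" and w: "w = egrad H x - H x *\<^sub>R x"
  shows "2 * dird w (dird u H) x * H x = \<gamma> * N x * inner w u"
    and "dird w (dird u (dird u H)) x + N x * \<gamma> / 2 * inner u u
      \<le> (H x + \<gamma> * N x / (2 * H x)) * dird u (dird u H) x"
proof -
  have x0: "x \<in> - {0}" "x \<noteq> 0" using x by auto
  have opn: "open (- {0::'a})" by auto
  define y where "y s = x + s *\<^sub>R u" for s :: real
  define U where "U = inner u u"
  define n' where "n' s = (\<Sum>b\<in>Basis. 2 * (dird b H (y s) * dird u (dird b H) (y s)))" for s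
  define n'' where "n'' s = (\<Sum>b\<in>Basis. 2 * (dird b H (y s) * dird u (dird u (dird b H)) (y s)
      + dird u (dird b H) (y s) * dird u (dird b H) (y s)))" for s
  define q where "q s = 1 + s * s * U" for s :: real
  have q: "inner (y s) (y s) = q s" "q s > 0" for s
  proof -
    show "inner (y s) (y s) = q s"
      using u x unfolding y_def q_def U_def
      by (simp add: inner_add_left inner_add_right inner_commute[of x u] dot_square_norm[of x])
    show "q s > 0" by (simp add: q_def U_def add_pos_nonneg)
  qed
  have y0: "y s \<in> - {0}" "y s \<noteq> 0" for s using q[of s] by auto
  have npos: "N z > 0" if "z \<noteq> 0" for z using egrad_pos(2)[OF H hom pos that] by (simp add: N_def)
  have Hpos: "H (y s) > 0" for s using pos y0 by blast
  note line = smooth_on_DERIV_line[where x = x and u = u, folded y_def]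
  have dn: "((\<lambda>s. N (y s)) has_real_derivative n' s) (at s)" for s
    unfolding N_def n'_def y_def
    by (rule norm_egrad_DERIV_line[OF H]) (use y0[of s] in \<open>simp add: y_def\<close>)
  have dn': "(n' has_real_derivative n'' s) (at s)" for s
    unfolding n'_def[abs_def] n''_def
    by (rule derivative_eq_intros line[OF smooth_on_dird[OF H] y0(1)]
        line[OF smooth_on_dird[OF smooth_on_dird[OF H]] y0(1)] refl)+ (simp add: algebra_simps)
  have dh: "((\<lambda>s. H (y s)) has_real_derivative dird u H (y s)) (at s)"
    "((\<lambda>s. dird u H (y s)) has_real_derivative dird u (dird u H) (y s)) (at s)" for s
    using line[OF H y0(1)] line[OF smooth_on_dird[OF H] y0(1)] by auto
  have dq: "(q has_real_derivative 2 * s * U) (at s)" for s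
    unfolding q_def[abs_def] by (auto intro!: derivative_eq_intros)
  \<comment> \<open>The logarithm of the quotient at the projection of \<open>y s\<close> to the sphere.\<close>
  define L where "L s = ln (N (y s)) - \<gamma> * ln (H (y s)) + \<gamma> / 2 * ln (q s)" for s
  define L' where "L' s = n' s / N (y s) - \<gamma> * (dird u H (y s) / H (y s)) + \<gamma> * (s * U / q s)" for s
  have dL: "(L has_real_derivative L' s) (at s)" for s
    unfolding L_def[abs_def] L'_def
    by (rule derivative_eq_intros dn dh(1) dq npos y0(2) Hpos q(2) refl)+ (simp add: field_simps)
  have dL': "(L' has_real_derivative ((n'' 0 * N (y 0) - n' 0 * n' 0) / (N (y 0) * N (y 0))
      - \<gamma> * ((dird u (dird u H) (y 0) * H (y 0) - dird u H (y 0) * dird u H (y 0)) / (H (y 0) * H (y 0)))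
      + \<gamma> * U)) (at 0)"
  proof -
    have "((\<lambda>s. s * U / q s) has_real_derivative U) (at 0)"
      by (rule derivative_eq_intros dq refl)+ (auto simp: q_def)
    moreover have "((\<lambda>s. n' s / N (y s)) has_real_derivative
        ((n'' 0 * N (y 0) - n' 0 * n' 0) / (N (y 0) * N (y 0)))) (at 0)"
      using npos[OF y0(2)[of 0]] by (intro DERIV_divide dn dn') auto
    moreover have "((\<lambda>s. dird u H (y s) / H (y s)) has_real_derivative
        ((dird u (dird u H) (y 0) * H (y 0) - dird u H (y 0) * dird u H (y 0)) / (H (y 0) * H (y 0)))) (at 0)"
      using Hpos[of 0] by (intro DERIV_divide dh) auto
    ultimately show ?thesis unfolding L'_def[abs_def]
      by (intro DERIV_add DERIV_diff DERIV_cmult)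
  qed
  have Lmax: "L s \<le> L 0" for s
  proof -
    have form: "L s = ln (N (y s /\<^sub>R norm (y s)) / H (y s /\<^sub>R norm (y s)) powr \<gamma>)" for s
    proof -
      have ny: "norm (y s) > 0" using y0[of s] by simp
      have N: "N (y s /\<^sub>R norm (y s)) = N (y s)"
        using homogeneous_dird(3)[OF H hom, of "inverse (norm (y s))" "y s"] ny by (simp add: N_def)
      have Hn: "H (y s /\<^sub>R norm (y s)) = H (y s) / norm (y s)"
        using hom[of "inverse (norm (y s))" "y s"] ny by (simp add: field_simps)
      have "ln (norm (y s)) = ln (q s) / 2"
        using q[of s] by (simp add: norm_eq_sqrt_inner ln_sqrt)
      then show ?thesis
        unfolding N Hn L_def using npos[OF y0(2)[of s]] Hpos[of s] ny
        by (simp add: ln_div ln_powr algebra_simps)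
    qed
    have "y 0 /\<^sub>R norm (y 0) = x" using x by (simp add: y_def)
    moreover have "N (y s /\<^sub>R norm (y s)) / H (y s /\<^sub>R norm (y s)) powr \<gamma> \<le> N x / H x powr \<gamma>"
      using y0[of s] by (intro max) simp
    moreover have "N (y s /\<^sub>R norm (y s)) / H (y s /\<^sub>R norm (y s)) powr \<gamma> > 0"
      using npos[of "y s /\<^sub>R norm (y s)"] pos[of "y s /\<^sub>R norm (y s)"] y0[of s] by simp
    ultimately show ?thesis unfolding form[of s] form[of 0] by (simp add: ln_mono)
  qed
  define S where "S = (\<Sum>b\<in>Basis. (dird u (dird b H) x)\<^sup>2)"
  define m where "m = dird w (dird u H) x"
  define T where "T = dird w (dird u (dird u H)) x"
  define B where "B = dird u (dird u H) x"
  have y00: "y 0 = x" by (simp add: y_def)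
  have gx: "egrad H x = w + H x *\<^sub>R x" using w by simp
  have n'0: "n' 0 = 2 * m"
    unfolding n'_def y00 m_def by (rule norm_egrad_first_variation[OF H hom x0(2) w])
  have n''0: "n'' 0 = 2 * (S + T - H x * B)"
  proof -
    have "n'' 0 = 2 * ((\<Sum>b\<in>Basis. dird b H x * dird b (dird u (dird u H)) x) + S)"
      unfolding n''_def y00 S_def sum.distrib[symmetric] sum_distrib_left
      by (intro sum.cong refl) (simp add: dird_third_commute[OF H opn x0(1)] power2_eq_square)
    also have "(\<Sum>b\<in>Basis. dird b H x * dird b (dird u (dird u H)) x)
        = inner (egrad (dird u (dird u H)) x) (egrad H x)"
      unfolding egrad_def by (simp add: inner_sum_right inner_sum_left_Basis)
    also have "\<dots> = T - H x * B"
      unfolding gx inner_add_right inner_scaleR_right T_def B_def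
        inner_egrad[OF smooth_on_dird[OF smooth_on_dird[OF H]] x0(1)]
      using homogeneous_dird(5)[OF H hom _ x0(2), of 1 u u] by simp
    finally show ?thesis by simp
  qed
  have uH: "dird u H x = inner w u"
    using inner_egrad[OF H x0(1), of u] u unfolding gx by (simp add: inner_add_left inner_commute[of x u])
  have wx: "inner w x = 0"
    using inner_egrad[OF H x0(1), of x] egrad_pos(1)[OF H hom pos x0(2)] x
    by (simp add: w inner_diff_left dot_square_norm)
  have Nx: "N x = inner w w + H x * H x"
    unfolding N_def gx power2_norm_eq_inner using wx x
    by (simp add: inner_add_left inner_add_right inner_commute[of x w] dot_square_norm[of x])
  have CS: "m\<^sup>2 \<le> S * N x"
  proof -
    have "m = inner (egrad (dird u H) x) w"
      unfolding m_def inner_egrad[OF smooth_on_dird[OF H] x0(1)] ..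
    then have "m\<^sup>2 \<le> inner (egrad (dird u H) x) (egrad (dird u H) x) * inner w w"
      using Cauchy_Schwarz_ineq by metis
    also have "inner (egrad (dird u H) x) (egrad (dird u H) x) = S"
      unfolding power2_norm_eq_inner[symmetric] norm_egrad S_def
      by (intro sum.cong refl) (simp only: dird_commute[OF H opn x0(1), of u])
    also have "S * inner w w \<le> S * N x"
      unfolding Nx S_def by (intro mult_left_mono sum_nonneg) auto
    finally show ?thesis .
  qed
  note tests = second_derivative_test_max[OF dL dL' Lmax]
  note res = max_point_arithmetic[OF g npos[OF x0(2)] pos[OF x0(2)], of m "inner w u" S T B U]
  have 1: "2 * m / N x - \<gamma> * (inner w u / H x) = 0"
    using tests(1) unfolding L'_def y00 n'0 uH by simp
  have 2: "((2 * (S + T - H x * B)) * N x - (2 * m) * (2 * m)) / (N x * N x)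
      - \<gamma> * ((B * H x - inner w u * inner w u) / (H x * H x)) + \<gamma> * U \<le> 0"
    using tests(2) unfolding y00 n'0 n''0 uH B_def[symmetric] .
  show "2 * dird w (dird u H) x * H x = \<gamma> * N x * inner w u"
    using res(1)[OF 1 2 CS] by (simp add: m_def)
  show "dird w (dird u (dird u H)) x + N x * \<gamma> / 2 * inner u u
      \<le> (H x + \<gamma> * N x / (2 * H x)) * dird u (dird u H) x"
    using res(2)[OF 1 2 CS] by (simp add: T_def U_def B_def)
qed

section \<open>Growth of the curvature function along the gradient\<close>

lemma second_derivative_expand:
  assumes H: "smooth_on U H" "open U" "y \<in> U"
  shows "dird u (dird v H) y = (\<Sum>a\<in>Basis. \<Sum>b\<in>Basis. inner u a * inner v b * dird a (dird b H) y)"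
proof -
  have l: "linear (\<lambda>u. dird u (dird v H) y)" "linear (\<lambda>v. dird u (dird v H) y)" for u v
    using dird_dird_bilinear(1)[OF H] by (simp_all add: bilinear_def)
  have "dird u (dird v H) y = dird (\<Sum>a\<in>Basis. inner u a *\<^sub>R a) (dird v H) y"
    by (simp only: euclidean_representation)
  also have "\<dots> = (\<Sum>a\<in>Basis. inner u a * dird a (dird v H) y)"
    by (simp only: linear_sum[OF l(1)] linear_scale[OF l(1)] real_scaleR_def)
  also have "\<dots> = (\<Sum>a\<in>Basis. inner u a * dird a (dird (\<Sum>b\<in>Basis. inner v b *\<^sub>R b) H) y)"
    by (simp only: euclidean_representation)
  also have "\<dots> = (\<Sum>a\<in>Basis. inner u a * (\<Sum>b\<in>Basis. inner v b * dird a (dird b H) y))"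
    by (simp only: linear_sum[OF l(2)] linear_scale[OF l(2)] real_scaleR_def)
  finally show ?thesis by (simp add: sum_distrib_left mult.assoc)
qed

lemma eventually_first_order_bound:
  fixes d :: "real \<Rightarrow> real"
  assumes "(d has_real_derivative d') (at 0)" "0 < e"
  shows "\<forall>\<^sub>F t in at_right 0. d t - d 0 - t * d' \<in> {- (e * t) .. e * t}"
proof -
  have "((\<lambda>t. (d (0 + t) - d 0) / t) \<longlongrightarrow> d') (at 0)"
    using assms(1) by (simp add: DERIV_def)
  then have "\<forall>\<^sub>F t in at 0. dist ((d (0 + t) - d 0) / t) d' < e" using assms(2) by (rule tendstoD)
  then have "\<forall>\<^sub>F t in at_right 0. dist ((d (0 + t) - d 0) / t) d' < e"
    by (simp add: eventually_at_split)
  moreover have "\<forall>\<^sub>F t in at_right (0::real). 0 < t" by (rule eventually_at_right_less)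
  ultimately show ?thesis
  proof eventually_elim
    case (elim t)
    have "\<bar>(d t - d 0) / t - d'\<bar> * t \<le> e * t" using elim by (intro mult_right_mono) (auto simp: dist_real_def)
    moreover have "\<bar>(d t - d 0) / t - d'\<bar> * t = \<bar>d t - d 0 - t * d'\<bar>"
    proof -
      have "\<bar>(d t - d 0) / t - d'\<bar> * t = \<bar>((d t - d 0) / t - d') * t\<bar>" using elim by (simp add: abs_mult)
      then show ?thesis using elim by (simp add: field_simps)
    qed
    ultimately show ?case by auto
  qed
qed

text \<open>
  The strict slack \<open>\<kappa>\<close> in the pointwise bound dominates the remainder of the first-order expansion of
  the Hessian. The expansion is made for the finitely many entries in a basis, so that the admissible \<open>t\<close> do not
  depend on \<open>u\<close>.
\<close>

lemma hessian_growth_along_line: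
  fixes H :: "'a::euclidean_space \<Rightarrow> real"
  assumes H: "smooth_on U H" "open U" "x \<in> U" and k: "0 < \<kappa>"
    and bound: "\<And>u. inner u x = 0 \<Longrightarrow>
      dird w (dird u (dird u H)) x + \<kappa> * inner u u \<le> c * dird u (dird u H) x"
  shows "\<forall>\<^sub>F t in at_right 0. \<forall>u. inner u x = 0 \<longrightarrow>
      dird u (dird u H) (x + t *\<^sub>R w) \<le> (1 + c * t) * dird u (dird u H) x"
proof -
  \<comment> \<open>The accuracy per matrix entry: summed over all entries, the errors amount to at most \<open>\<kappa> t \<bar>u\<bar>\<^sup>2\<close>.\<close>
  define e where "e = \<kappa> / (DIM('a) * DIM('a))"
  have e: "e > 0" using k by (simp add: e_def)
  define d where "d a b t = dird a (dird b H) (x + t *\<^sub>R w)" for a b t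
  define d' where "d' a b = dird w (dird a (dird b H)) x" for a b
  have dd: "(d a b has_real_derivative d' a b) (at 0)" for a b
    using smooth_on_DERIV_line[OF smooth_on_dird[OF smooth_on_dird[OF H(1)]], of x 0 w a b] H(3)
    by (simp add: d_def[abs_def] d'_def)
  have "\<forall>\<^sub>F t in at_right 0. \<forall>a\<in>Basis. \<forall>b\<in>Basis. d a b t - d a b 0 - t * d' a b \<in> {- (e * t) .. e * t}"
    by (intro eventually_ball_finite finite_Basis ballI eventually_first_order_bound dd e)
  moreover have "\<forall>\<^sub>F t in at_right 0. x + t *\<^sub>R w \<in> U"
  proof -
    have "((\<lambda>t. x + t *\<^sub>R w) \<longlongrightarrow> x + 0 *\<^sub>R w) (at_right 0)" by (intro tendsto_intros)
    then show ?thesis using topological_tendstoD[OF _ H(2)] H(3) by simp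
  qed
  moreover have "\<forall>\<^sub>F t in at_right (0::real). 0 < t" by (rule eventually_at_right_less)
  ultimately show ?thesis
  proof eventually_elim
    case (elim t)
    show ?case
    proof (intro allI impI)
      fix u assume u: "inner u x = 0"
      define q where "q f = (\<Sum>a\<in>Basis. \<Sum>b\<in>Basis. inner u a * inner u b * f a b)" for f :: "'a \<Rightarrow> 'a \<Rightarrow> real"
      have qy: "dird u (dird u H) y = q (\<lambda>a b. dird a (dird b H) y)" if "y \<in> U" for y
        unfolding q_def by (rule second_derivative_expand[OF H(1,2) that])
      have qd: "dird w (dird u (dird u H)) x = q d'"
      proof -
        have "((\<lambda>y. q (\<lambda>a b. dird a (dird b H) y)) has_derivative (\<lambda>w. q (\<lambda>a b. dird w (dird a (dird b H)) x))) (at x)"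
          unfolding q_def
          by (intro has_derivative_sum has_derivative_mult_right
              smooth_on_has_derivative[OF smooth_on_dird[OF smooth_on_dird[OF H(1)]] H(3)])
        then have "dird w (\<lambda>y. q (\<lambda>a b. dird a (dird b H) y)) x = q d'"
          unfolding d'_def by (rule dird_eqI)
        moreover have "dird w (dird u (dird u H)) x = dird w (\<lambda>y. q (\<lambda>a b. dird a (dird b H) y)) x"
          by (rule dird_cong[OF smooth_on_dird[OF smooth_on_dird[OF H(1)]] H(2) qy H(3)])
        ultimately show ?thesis by simp
      qed
      have "q (\<lambda>a b. d a b t) - q (\<lambda>a b. d a b 0) - t * q d'
          = q (\<lambda>a b. d a b t - d a b 0 - t * d' a b)"
        unfolding q_def by (simp add: sum_subtractf sum_distrib_left right_diff_distrib sum.distrib algebra_simps)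
      also have "\<dots> \<le> (\<Sum>a\<in>(Basis :: 'a set). \<Sum>b\<in>(Basis :: 'a set). inner u u * (e * t))"
        unfolding q_def
      proof (intro sum_mono)
        fix a b :: 'a assume ab: "a \<in> Basis" "b \<in> Basis"
        have "\<bar>inner u a\<bar> * \<bar>inner u b\<bar> \<le> norm u * norm u"
          using ab by (intro mult_mono Basis_le_norm) auto
        moreover have "\<bar>d a b t - d a b 0 - t * d' a b\<bar> \<le> e * t"
        proof -
          have "d a b t - d a b 0 - t * d' a b \<in> {- (e * t) .. e * t}" using elim(1) ab by blast
          then show ?thesis unfolding atLeastAtMost_iff by linarith
        qed
        ultimately have "\<bar>inner u a * inner u b\<bar> * \<bar>d a b t - d a b 0 - t * d' a b\<bar> \<le> inner u u * (e * t)"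
          using e \<open>0 < t\<close> by (intro mult_mono) (auto simp: abs_mult norm_eq_sqrt_inner)
        then show "inner u a * inner u b * (d a b t - d a b 0 - t * d' a b) \<le> inner u u * (e * t)"
          by (simp add: abs_mult[symmetric])
      qed
      also have "\<dots> = t * (\<kappa> * inner u u)" by (simp add: e_def)
      finally have "dird u (dird u H) (x + t *\<^sub>R w)
          \<le> dird u (dird u H) x + t * (dird w (dird u (dird u H)) x + \<kappa> * inner u u)"
        using qy[OF elim(2)] qy[OF H(3)] unfolding qd by (simp add: d_def algebra_simps)
      also have "\<dots> \<le> dird u (dird u H) x + t * (c * dird u (dird u H) x)"
        using bound[OF u] \<open>0 < t\<close> by (intro add_left_mono mult_left_mono) auto
      finally show "dird u (dird u H) (x + t *\<^sub>R w) \<le> (1 + c * t) * dird u (dird u H) x"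
        by (simp add: algebra_simps)
    qed
  qed
qed

text \<open>
  The tangent spaces at \<open>x\<close> and \<open>x'\<close> are compared by the projection along \<open>y\<close>, which does not change the form
  at \<open>y\<close> because the Hessian of \<open>H\<close> annihilates the radial direction; this replaces parallel transport. The
  factor \<open>\<bar>y\<bar>\<^sup>3\<close> collects one \<open>\<bar>y\<bar>\<close> from the homogeneity of the Hessian and \<open>\<bar>y\<bar>\<^sup>2\<close> from the distortion of the
  norm by the projection. As \<open>\<bar>y\<bar>\<^sup>2 = 1 + t\<^sup>2 \<bar>w\<bar>\<^sup>2\<close>, it is invisible to first order in \<open>t\<close>.
\<close>

lemma elem_sym_growth:
  fixes H :: "'a::euclidean_space \<Rightarrow> real"
  defines "B \<equiv> \<lambda>y u v. dird u (dird v H) y"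
  assumes dim: "DIM('a) = n + 1"
    and H: "smooth_on (- {0}) H" and hom: "\<And>c y. 0 < c \<Longrightarrow> H (c *\<^sub>R y) = c * H y"
    and x: "norm x = 1" "inner w x = 0" and c: "0 \<le> c"
    and y: "y = x + t *\<^sub>R w" and xt: "x' = y /\<^sub>R norm y"
    and growth: "\<And>u. inner u x = 0 \<Longrightarrow> B y u u \<le> c * B x u u"
    and e: "principal_frame n x (B x) e" "\<And>i. i < n \<Longrightarrow> 0 \<le> B x (e i) (e i)"
    and e': "principal_frame n x' (B x') e'" "\<And>i. i < n \<Longrightarrow> 0 \<le> B x' (e' i) (e' i)"
  shows "elem_sym n k (\<lambda>i. B x' (e' i) (e' i)) \<le> (norm y ^ 3 * c) ^ k * elem_sym n k (\<lambda>i. B x (e i) (e i))"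
proof (rule elem_sym_mono_scaled[OF e'(2)])
  fix i assume i: "i < n"
  have opn: "open (- {0::'a})" by auto
  have x0: "x \<noteq> 0" using x by auto
  have yx: "inner y x = 1" using x by (simp add: y inner_add_left dot_square_norm)
  have y0: "y \<noteq> 0" using yx by auto
  define s where "s = norm y"
  have s: "s > 0" "inner y y = s * s" using y0 by (simp_all add: s_def dot_square_norm power2_eq_square)
  have x': "x' = inverse s *\<^sub>R y" "x' \<noteq> 0" using xt y0 by (simp_all add: s_def)
  define P where "P v = v - inner v x *\<^sub>R y" for v
  have bil: "bilinear (B z)" if "z \<noteq> 0" for z
    unfolding B_def by (rule dird_dird_bilinear(1)[OF H opn]) (use that in simp)
  have "B x' (e' i) (e' i) \<le> (s * c) * (s * s) * B x (e i) (e i)"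
  proof (rule eigenvalue_comparison[OF dim bil[OF x'(2)] e'(1) bil[OF x0] e(1) x0])
    show "linear P" unfolding P_def
      by (rule linearI) (auto simp: inner_add_left algebra_simps)
    show "inner (P v) x = 0" for v using yx by (simp add: P_def inner_diff_left)
    show "0 \<le> s * c" using s c by simp
    show "0 \<le> B x (e i) (e i)" using e(2) i .
    fix v assume "inner v x' = 0"
    then have vy: "inner v y = 0" using s by (simp add: x'(1))
    have "inner v x = inner v (x - inverse (s * s) *\<^sub>R y)" using vy by (simp add: inner_diff_right)
    then have "(inner v x)\<^sup>2 \<le> inner v v * inner (x - inverse (s * s) *\<^sub>R y) (x - inverse (s * s) *\<^sub>R y)"
      by (metis Cauchy_Schwarz_ineq)
    also have "inner (x - inverse (s * s) *\<^sub>R y) (x - inverse (s * s) *\<^sub>R y) = 1 - inverse (s * s)"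
      using x yx s by (simp add: inner_diff_left inner_diff_right inner_commute[of x y] dot_square_norm[of x])
        (simp add: field_simps)
    finally have "(inner v x)\<^sup>2 * (s * s) \<le> inner v v * (1 - inverse (s * s)) * (s * s)"
      by (intro mult_right_mono) auto
    also have "\<dots> = inner v v * (s * s - 1)" using s by (simp add: field_simps)
    finally show "inner (P v) (P v) \<le> s * s * inner v v"
      using vy s by (simp add: P_def inner_diff_left inner_diff_right inner_commute[of y v] power2_eq_square algebra_simps)
    have "B x' v v = s * B y v v"
      using homogeneous_dird(2)[OF H hom, of "inverse s" y v v] s y0
      by (simp add: B_def x'(1) field_simps)
    also have "B y v v = B y (P v) (P v)"
    proof -
      have "B y z y = 0" "B y y z = 0" for z
        using homogeneous_dird(4)[OF H hom _ y0, of 1 z] dird_dird_bilinear(2)[OF H opn, of y z y] y0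
        by (auto simp: B_def)
      then show ?thesis unfolding P_def
        by (simp add: bilinear_lsub[OF bil[OF y0]] bilinear_rsub[OF bil[OF y0]]
            bilinear_lmul[OF bil[OF y0]] bilinear_rmul[OF bil[OF y0]])
    qed
    also have "s * B y (P v) (P v) \<le> s * (c * B x (P v) (P v))"
      using s growth[of "P v"] yx by (intro mult_left_mono) (auto simp: P_def inner_diff_left)
    finally show "B x' v v \<le> s * c * B x (P v) (P v)" by (simp add: mult.assoc)
  qed (use i in auto)
  then show "B x' (e' i) (e' i) \<le> norm y ^ 3 * c * B x (e i) (e i)"
    by (simp add: s_def power3_eq_cube mult_ac)
qed

lemma derivative_nonpos_at_right_max:
  fixes d :: "real \<Rightarrow> real"
  assumes d: "(d has_real_derivative D) (at 0)" and le: "\<forall>\<^sub>F t in at_right 0. d t \<le> d 0"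
  shows "D \<le> 0"
proof (rule ccontr)
  assume "\<not> D \<le> 0"
  then obtain e where e: "e > 0" "\<forall>t>0. t < e \<longrightarrow> d 0 < d (0 + t)"
    using DERIV_pos_inc_right[OF d] by auto
  have "\<forall>\<^sub>F t in at_right 0. t \<in> {0<..<e}" using e(1) by (intro eventually_at_right_real)
  with le have "\<forall>\<^sub>F t in at_right (0::real). False"
    by eventually_elim (use e(2) in force)
  then show False by simp
qed

text \<open>
  At each point the equation is used only in a principal frame, where its left-hand side is an elementary
  symmetric function of nonnegative numbers and hence monotone in them.
\<close>

lemma principal_curvatures_sphere:
  fixes h :: "'a::euclidean_space \<Rightarrow> real"
  defines "B \<equiv> \<lambda>z u v. dird u (dird v (hom_ext h)) z"
  assumes dim: "DIM('a) = n + 1" and h: "smooth_on_sphere h" "strictly_convex_on_sphere h"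
    and eq: "\<forall>e. tangent_frame n z e \<longrightarrow> sigma_k k (frame_matrix n e (hess_plus h z)) = m"
    and z: "norm z = 1"
  obtains e where "principal_frame n z (B z) e" "\<forall>i<n. 0 \<le> B z (e i) (e i)"
    "elem_sym n k (\<lambda>i. B z (e i) (e i)) = m"
proof -
  note H = smooth_on_hom_ext[OF h(1)]
  have z0: "z \<in> - {0}" "z \<noteq> 0" using z by auto
  have opn: "open (- {0::'a})" by auto
  obtain e where e: "principal_frame n z (B z) e"
    using principal_frame_exists[OF dird_dird_bilinear(1)[OF H opn z0(1)] _ dim z0(2)]
      dird_dird_bilinear(2)[OF H opn z0(1)] unfolding B_def by metis
  then have tf: "tangent_frame n z e" by (simp add: principal_frame_def)
  have hp: "hess_plus h z (e i) (e j) = B z (e i) (e j)" if "i < n" "j < n" for i j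
    using tf that unfolding B_def by (intro hess_plus_eq[OF h(1) z]) (auto simp: tangent_frame_def)
  have "frame_matrix n e (hess_plus h z) = frame_matrix n e (B z)"
    unfolding frame_matrix_def by (rule eq_matI) (auto simp: hp)
  then have "elem_sym n k (\<lambda>i. B z (e i) (e i)) = m"
    using eq tf sigma_k_principal_frame[OF e] by metis
  moreover have "0 \<le> B z (e i) (e i)" if i: "i < n" for i
  proof -
    have "inner (e i) z = 0" "inner (e i) (e i) = 1" using tf i by (auto simp: tangent_frame_def)
    then have "hess_plus h z (e i) (e i) > 0"
      using h(2) z unfolding strictly_convex_on_sphere_def by force
    then show ?thesis using hp[OF i i] by simp
  qed
  ultimately show thesis using that e by blast
qed

text \<open>
  Along \<open>x + t w\<close>, the equation determines \<open>\<sigma>\<^sub>k\<close> at the projected point, and \<open>elem_sym_growth\<close> bounds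
  it. The function \<open>d\<close> is the logarithm of the ratio of the two, up to a constant. It has a one-sided local
  maximum at \<open>t = 0\<close>, so its derivative there is nonpositive. The part of the derivative that comes from the power of
  \<open>N\<close> is nonnegative by the first-order condition and \<open>q \<le> k + 1\<close>, and the rest is the claim.
\<close>

lemma max_point_estimate:
  fixes f h :: "'a::euclidean_space \<Rightarrow> real"
  defines "N \<equiv> \<lambda>y. (h y)\<^sup>2 + (norm (sphere_grad h y))\<^sup>2"
  assumes dim: "DIM('a) = n + 1" and q: "q \<le> real k + 1" and g: "0 < \<gamma>" "\<gamma> < 2"
    and f: "smooth_on_sphere f" "\<forall>x\<in>sphere 0 1. f x > 0"
    and h: "smooth_on_sphere h" "\<forall>x\<in>sphere 0 1. h x > 0" "strictly_convex_on_sphere h"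
    and eq: "\<forall>x\<in>sphere 0 1. \<forall>e. tangent_frame n x e \<longrightarrow>
       sigma_k k (frame_matrix n e (hess_plus h x)) =
         f x * h x powr (p - 1) * N x powr ((real k + 1 - q) / 2)"
    and x: "norm x = 1"
    and max: "\<And>y. norm y = 1 \<Longrightarrow> N y / h y powr \<gamma> \<le> N x / h x powr \<gamma>"
  shows "(p - 1) * (norm (sphere_grad h x))\<^sup>2 / h x
      \<le> norm (sphere_grad f x) * norm (sphere_grad h x) / f x + real k * (h x + \<gamma> * N x / (2 * h x))"
proof -
  define H F where "H = hom_ext h" and "F = hom_ext f"
  note H = smooth_on_hom_ext[OF h(1), folded H_def] and F = smooth_on_hom_ext[OF f(1), folded F_def]
  have homH: "0 < c \<Longrightarrow> H (c *\<^sub>R y) = c * H y" for c y by (simp add: H_def hom_ext_scale)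
  have homF: "0 < c \<Longrightarrow> F (c *\<^sub>R y) = c * F y" for c y by (simp add: F_def hom_ext_scale)
  have posH: "y \<noteq> 0 \<Longrightarrow> H y > 0" for y using hom_ext_pos[OF h(2)] by (simp add: H_def)
  have posF: "y \<noteq> 0 \<Longrightarrow> F y > 0" for y using hom_ext_pos[OF f(2)] by (simp add: F_def)
  have Hs: "H y = h y" "F y = f y" if "norm y = 1" for y
    using that by (simp_all add: H_def F_def hom_ext_sphere)
  define NH where "NH y = (norm (egrad H y))\<^sup>2" for y
  have NH: "N y = NH y" if "norm y = 1" for y
    using square_plus_norm_sphere_grad[OF h(1) that] by (simp add: N_def NH_def H_def)
  have NHpos: "NH y > 0" if "y \<noteq> 0" for y
    unfolding NH_def by (rule egrad_pos(2)[OF H homH posH that])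
  have posN: "N z > 0" if "norm z = 1" for z
  proof -
    have "z \<noteq> 0" using that by auto
    then show ?thesis using NHpos NH[OF that] by simp
  qed
  define w where "w = sphere_grad h x"
  have w: "w = egrad H x - H x *\<^sub>R x" "inner w x = 0"
    using sphere_grad_eq[OF h(1) x] Hs[OF x] by (simp_all add: w_def H_def)
  have x0: "x \<noteq> 0" using x by auto
  define c where "c = H x + \<gamma> * NH x / (2 * H x)"
  have c: "c > 0" using posH[OF x0] NHpos[OF x0] g by (simp add: c_def add_pos_pos)
  have maxH: "(norm (egrad H y))\<^sup>2 / H y powr \<gamma> \<le> (norm (egrad H x))\<^sup>2 / H x powr \<gamma>" if "norm y = 1" for y
    using max[OF that] NH[OF that] NH[OF x] Hs[OF that] Hs[OF x] by (simp add: NH_def)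
  note mp = max_point_hessian_bound[OF H homH posH x g maxH _ w(1), folded NH_def c_def]
  have opn: "open (- {0::'a})" by auto
  have growth: "\<forall>\<^sub>F t in at_right 0. \<forall>u. inner u x = 0 \<longrightarrow>
      dird u (dird u H) (x + t *\<^sub>R w) \<le> (1 + c * t) * dird u (dird u H) x"
  proof (rule hessian_growth_along_line[OF H opn])
    show "0 < NH x * \<gamma> / 2" using NHpos[OF x0] g by simp
  qed (use mp(2) x0 in \<open>auto simp: c_def\<close>)
  define W where "W = inner w w"
  define r where "r = (real k + 1 - q) / 2"
  have yn: "inner (x + t *\<^sub>R w) (x + t *\<^sub>R w) = 1 + t * t * W" "1 + t * t * W > 0" for t
    using w(2) x by (simp_all add: inner_add_left inner_add_right inner_commute[of x w]
        dot_square_norm[of x] W_def add_pos_nonneg)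
  have y0: "x + t *\<^sub>R w \<noteq> 0" for t using yn[of t] by auto
  \<comment> \<open>The terms with \<open>1 + t\<^sup>2 W\<close> come from the projection to the sphere: \<open>p\<close> from the degrees of \<open>F\<close> and \<open>H\<^sup>p\<^sup>-\<^sup>1\<close>, and \<open>3k\<close> from the factor in the growth bound.\<close>
  define d where "d t = ln (F (x + t *\<^sub>R w)) + (p - 1) * ln (H (x + t *\<^sub>R w)) + r * ln (NH (x + t *\<^sub>R w))
     - (p + 3 * real k) / 2 * ln (1 + t * t * W) - real k * ln (1 + c * t)" for t
  have le: "\<forall>\<^sub>F t in at_right 0. d t \<le> d 0"
    using growth eventually_at_right_less[of "0::real"]
  proof eventually_elim
    case (elim t)
    define y where "y = x + t *\<^sub>R w"
    define s where "s = norm y"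
    define x' where "x' = y /\<^sub>R norm y"
    have yy: "y \<noteq> 0" "s > 0" using y0 by (simp_all add: y_def s_def)
    have x': "norm x' = 1" "x' = inverse s *\<^sub>R y" using yy by (simp_all add: x'_def s_def)
    define m where "m z = f z * h z powr (p - 1) * N z powr r" for z
    have eqm: "\<forall>e. tangent_frame n z e \<longrightarrow> sigma_k k (frame_matrix n e (hess_plus h z)) = m z"
      if "norm z = 1" for z
      using eq that by (simp add: m_def r_def)
    obtain e where e: "principal_frame n x (\<lambda>u v. dird u (dird v H) x) e"
      "\<forall>i<n. 0 \<le> dird (e i) (dird (e i) H) x"
      "elem_sym n k (\<lambda>i. dird (e i) (dird (e i) H) x) = m x"
      by (rule principal_curvatures_sphere[OF dim h(1,3) eqm[OF x] x, folded H_def], rule that)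
    obtain e' where e': "principal_frame n x' (\<lambda>u v. dird u (dird v H) x') e'"
      "\<forall>i<n. 0 \<le> dird (e' i) (dird (e' i) H) x'"
      "elem_sym n k (\<lambda>i. dird (e' i) (dird (e' i) H) x') = m x'"
      by (rule principal_curvatures_sphere[OF dim h(1,3) eqm[OF x'(1)] x'(1), folded H_def], rule that)
    have ct: "1 + c * t > 0" using c elim by (simp add: add_pos_pos)
    have "m x' \<le> (norm y ^ 3 * (1 + c * t)) ^ k * m x"
      unfolding e(3)[symmetric] e'(3)[symmetric]
      by (rule elem_sym_growth[OF dim H homH x w(2) _ y_def x'_def _ e(1) _ e'(1)])
         (use ct elim e(2) e'(2) in \<open>auto simp: y_def\<close>)
    moreover have mpos: "m z > 0" if "norm z = 1" for z
    proof -
      have "f z > 0" "h z > 0" "N z > 0" using posN that f(2) h(2) by auto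
      then show ?thesis unfolding m_def by (intro mult_pos_pos) auto
    qed
    ultimately have "ln (m x') \<le> ln ((s ^ 3 * (1 + c * t)) ^ k * m x)"
      using x'(1) by (simp add: s_def ln_mono)
    also have "\<dots> = real k * (3 * ln s + ln (1 + c * t)) + ln (m x)"
      using mpos[OF x] yy ct by (simp add: ln_mult ln_realpow)
    finally have lnm: "ln (m x') \<le> real k * (3 * ln s + ln (1 + c * t)) + ln (m x)" .
    have lm: "ln (m z) = ln (F z) + (p - 1) * ln (H z) + r * ln (NH z)" if "norm z = 1" for z
    proof -
      have "f z > 0" "h z > 0" "N z > 0" using posN that f(2) h(2) by auto
      then show ?thesis unfolding m_def NH[OF that, symmetric] Hs[OF that] by (simp add: ln_mult ln_powr)
    qed
    have "F x' = F y / s" "H x' = H y / s" "NH x' = NH y"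
      using homF[of "inverse s" y] homH[of "inverse s" y] homogeneous_dird(3)[OF H homH, of "inverse s" y] yy
      by (simp_all add: x'(2) NH_def field_simps)
    then have lm': "ln (m x') = ln (F y) - ln s + (p - 1) * (ln (H y) - ln s) + r * ln (NH y)"
      using lm[OF x'(1)] yy posF[OF yy(1)] posH[OF yy(1)] by (simp add: ln_div)
    have lns: "ln (1 + t * t * W) = 2 * ln s"
      using yn[of t] by (simp add: s_def y_def norm_eq_sqrt_inner ln_sqrt)
    have "d t = ln (m x') - real k * (3 * ln s + ln (1 + c * t))"
      unfolding d_def y_def[symmetric] lm' lns by (simp add: algebra_simps)
    moreover have "d 0 = ln (m x)" using lm[OF x] by (simp add: d_def)
    ultimately show ?case using lnm by simp
  qed
  have dN: "((\<lambda>t. NH (x + t *\<^sub>R w)) has_real_derivative 2 * dird w (dird w H) x) (at 0)"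
    using norm_egrad_DERIV_line[OF H, of x 0 w] norm_egrad_first_variation[OF H homH x0 w(1), of w] x0
    by (simp add: NH_def[abs_def])
  have dF: "((\<lambda>t. F (x + t *\<^sub>R w)) has_real_derivative dird w F x) (at 0)"
    using smooth_on_DERIV_line[OF F, of x 0 w] x0 by simp
  have dH: "((\<lambda>t. H (x + t *\<^sub>R w)) has_real_derivative dird w H x) (at 0)"
    using smooth_on_DERIV_line[OF H, of x 0 w] x0 by simp
  have "(d has_real_derivative dird w F x / F x + (p - 1) * (dird w H x / H x)
      + r * (2 * dird w (dird w H) x / NH x) - real k * c) (at 0)"
    unfolding d_def[abs_def]
    by (rule derivative_eq_intros dF dH dN refl | use posF[OF x0] posH[OF x0] NHpos[OF x0] in \<open>simp; fail\<close>)+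
      (simp add: field_simps)
  from derivative_nonpos_at_right_max[OF this le]
  have D: "dird w F x / F x + (p - 1) * (dird w H x / H x)
      + r * (2 * dird w (dird w H) x / NH x) - real k * c \<le> 0" .
  have gx: "egrad H x = w + H x *\<^sub>R x" using w(1) by simp
  have wH: "dird w H x = (norm w)\<^sup>2"
    using inner_egrad[OF H, of x w] x0 w(2)
    unfolding gx by (simp add: inner_add_left inner_commute[of x w] power2_norm_eq_inner)
  have "egrad F x = sphere_grad f x + F x *\<^sub>R x"
    using sphere_grad_eq(1)[OF f(1) x] Hs[OF x] by (simp add: F_def)
  then have "dird w F x = inner (sphere_grad f x) w"
    using inner_egrad[OF F, of x w] x0 w(2) by (simp add: inner_add_left inner_commute[of x w])
  then have "- (norm (sphere_grad f x) * norm w) \<le> dird w F x"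
    using Cauchy_Schwarz_ineq2[of "sphere_grad f x" w] by (simp add: abs_le_iff)
  from divide_right_mono[OF this, of "F x"] posF[OF x0]
  have "- (norm (sphere_grad f x) * norm w / F x) \<le> dird w F x / F x" by simp
  moreover have "0 \<le> r * (2 * dird w (dird w H) x / NH x)"
  proof -
    have "2 * dird w (dird w H) x * H x = \<gamma> * NH x * inner w w"
      by (rule mp(1)) (use w(2) in auto)
    then have "2 * dird w (dird w H) x * H x \<ge> 0" using NHpos[OF x0] g by simp
    then have "dird w (dird w H) x \<ge> 0" using posH[OF x0] by (simp add: zero_le_mult_iff)
    then show ?thesis using q NHpos[OF x0] by (simp add: r_def)
  qed
  ultimately have "(p - 1) * ((norm w)\<^sup>2 / H x) \<le> norm (sphere_grad f x) * norm w / F x + real k * c"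
    using D unfolding wH by linarith
  then show ?thesis
    using Hs[OF x] NH[OF x] by (simp add: w_def c_def)
qed

section \<open>The gradient estimate\<close>

lemma continuous_on_sphere_smooth:
  fixes h :: "'a::euclidean_space \<Rightarrow> real"
  assumes h: "smooth_on_sphere h"
  shows "continuous_on (sphere 0 1) h" "continuous_on (sphere 0 1) (\<lambda>x. norm (sphere_grad h x))"
proof -
  note H = smooth_on_hom_ext[OF h]
  have sub: "sphere 0 1 \<subseteq> - {0::'a}" by auto
  have "continuous_on (sphere 0 1) (hom_ext h)"
    using smooth_on_continuous[OF H] sub continuous_on_subset by blast
  then show c: "continuous_on (sphere 0 1) h"
    by (rule continuous_on_eq) (auto simp: hom_ext_sphere)
  have "continuous_on (sphere 0 1) (egrad (hom_ext h))"
    unfolding egrad_def[abs_def]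
    using smooth_on_continuous[OF smooth_on_dird[OF H]] sub continuous_on_subset
    by (intro continuous_intros) blast
  then have "continuous_on (sphere 0 1) (\<lambda>x. norm (egrad (hom_ext h) x - h x *\<^sub>R x))"
    using c by (intro continuous_intros)
  then show "continuous_on (sphere 0 1) (\<lambda>x. norm (sphere_grad h x))"
    by (rule continuous_on_eq) (auto simp: sphere_grad_eq(1)[OF h])
qed

lemma INF_sphere_pos:
  fixes f :: "'a::euclidean_space \<Rightarrow> real"
  assumes "smooth_on_sphere f" "\<forall>x\<in>sphere 0 1. f x > 0"
  shows "(INF x\<in>sphere 0 1. f x) > 0" "norm x = 1 \<Longrightarrow> (INF x\<in>sphere 0 1. f x) \<le> f x"
proof -
  have ne: "sphere 0 1 \<noteq> ({} :: 'a set)" by simp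
  obtain z where z: "z \<in> sphere 0 1" "\<forall>y\<in>sphere 0 1. f z \<le> f y"
    using continuous_attains_inf[OF compact_sphere ne continuous_on_sphere_smooth(1)[OF assms(1)]] by blast
  have "f z \<le> (INF x\<in>sphere 0 1. f x)" using z ne by (intro cINF_greatest) auto
  then show "(INF x\<in>sphere 0 1. f x) > 0" using assms(2) z(1) by force
  have "bdd_below (f ` sphere 0 1)" using z by (intro bdd_belowI2[of _ "f z"]) auto
  then show "(INF x\<in>sphere 0 1. f x) \<le> f x" if "norm x = 1"
    using that by (intro cINF_lower) auto
qed

lemma continuous_le_SUP_sphere:
  fixes g :: "'a::euclidean_space \<Rightarrow> real"
  assumes "continuous_on (sphere 0 1) g" "norm x = 1"
  shows "g x \<le> (SUP y\<in>sphere 0 1. g y)"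
proof -
  have "compact (g ` sphere 0 1)" using assms(1) by (intro compact_continuous_image) auto
  then have "bdd_above (g ` sphere 0 1)" by (intro bounded_imp_bdd_above compact_imp_bounded)
  then show ?thesis using assms(2) by (intro cSUP_upper) auto
qed

lemma norm_sphere_grad_le_C1_norm:
  fixes f :: "'a::euclidean_space \<Rightarrow> real"
  assumes f: "smooth_on_sphere f" and x: "norm x = 1"
  shows "norm (sphere_grad f x) \<le> C1_norm f"
proof -
  have "\<bar>f x\<bar> \<le> (SUP x\<in>sphere 0 1. \<bar>f x\<bar>)"
    using continuous_on_sphere_smooth(1)[OF f] x
    by (intro continuous_le_SUP_sphere continuous_on_rabs)
  moreover have "norm (sphere_grad f x) \<le> (SUP x\<in>sphere 0 1. norm (sphere_grad f x))"
    by (rule continuous_le_SUP_sphere[OF continuous_on_sphere_smooth(2)[OF f] x])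
  ultimately show ?thesis unfolding C1_norm_def by linarith
qed

text \<open>
  With \<open>s\<^sup>2 = h\<^sup>2 + a\<^sup>2\<close> the assumption becomes \<open>(2(p - 1) - k\<gamma>) s\<^sup>2 \<le> 2Cah + (2k + 2(p - 1)) h\<^sup>2\<close>. Bounding \<open>a\<close> and one
  factor \<open>h\<close> on the right by \<open>s\<close> allows to divide by \<open>s\<close>.
\<close>

lemma estimate_arithmetic:
  fixes a h C \<gamma> p k :: real
  assumes est: "(p - 1) * a\<^sup>2 / h \<le> C * a + k * (h + \<gamma> * (h\<^sup>2 + a\<^sup>2) / (2 * h))"
    and pos: "0 < h" "0 \<le> a" "0 \<le> C" "0 \<le> k" "1 < p" and \<delta>: "0 < 2 * (p - 1) - k * \<gamma>"
  shows "h\<^sup>2 + a\<^sup>2 \<le> ((2 * C + 2 * k + 2 * (p - 1)) / (2 * (p - 1) - k * \<gamma>))\<^sup>2 * h\<^sup>2"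
proof -
  define s where "s = sqrt (h\<^sup>2 + a\<^sup>2)"
  define d where "d = 2 * (p - 1) - k * \<gamma>"
  define E where "E = 2 * C + 2 * k + 2 * (p - 1)"
  have s2: "h\<^sup>2 + a\<^sup>2 = s\<^sup>2" by (simp add: s_def)
  have s: "0 < s" "a \<le> s" "h \<le> s"
    using pos by (auto simp: s_def add_pos_nonneg intro!: real_le_rsqrt)
  have "(p - 1) * a\<^sup>2 / h * (2 * h) \<le> (C * a + k * (h + \<gamma> * (h\<^sup>2 + a\<^sup>2) / (2 * h))) * (2 * h)"
    using est pos by (intro mult_right_mono) auto
  moreover have "(p - 1) * a\<^sup>2 / h * (2 * h) = 2 * (p - 1) * a\<^sup>2" using pos by simp
  moreover have "(C * a + k * (h + \<gamma> * X / (2 * h))) * (2 * h) = 2 * C * (a * h) + 2 * k * h\<^sup>2 + k * \<gamma> * X" for X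
    using pos by (simp add: field_simps power2_eq_square)
  ultimately have "2 * (p - 1) * a\<^sup>2 \<le> 2 * C * (a * h) + 2 * k * h\<^sup>2 + k * \<gamma> * (h\<^sup>2 + a\<^sup>2)"
    by simp
  then have "d * s\<^sup>2 \<le> 2 * C * (a * h) + (2 * k + 2 * (p - 1)) * (h * h)"
    unfolding d_def s2[symmetric] by (simp add: algebra_simps power2_eq_square)
  also have "\<dots> \<le> 2 * C * (s * h) + (2 * k + 2 * (p - 1)) * (s * h)"
    using s pos by (intro add_mono mult_left_mono mult_right_mono) auto
  also have "\<dots> = (E * h) * s" by (simp add: E_def algebra_simps)
  finally have "(d * s) * s \<le> (E * h) * s" by (simp add: power2_eq_square)
  then have "d * s \<le> E * h" using s(1) by (simp only: mult_le_cancel_right_pos)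
  then have "s \<le> E / d * h" using \<delta> by (simp add: d_def field_simps)
  then have "s\<^sup>2 \<le> (E / d * h)\<^sup>2" using s(1) by (intro power_mono) auto
  then show ?thesis unfolding s2 E_def[symmetric] d_def[symmetric] by (simp only: power_mult_distrib)
qed

theorem lemma3p1:
  fixes n k :: nat and p q \<gamma> fmin fC1 :: real
  assumes "DIM('a::euclidean_space) = n + 1"
    and "1 \<le> k" and "k \<le> n"
    and "1 < p" and "p \<le> real k + 1" and "q \<le> real k + 1"
    and "0 < \<gamma>" and "\<gamma> < 2 * (p - 1) / real k"
  shows "\<exists>M\<ge>2. \<forall>(f :: 'a \<Rightarrow> real) (h :: 'a \<Rightarrow> real).
    smooth_on_sphere f \<and> (\<forall>x\<in>sphere 0 1. f x > 0) \<and>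
    (INF x\<in>sphere 0 1. f x) = fmin \<and> C1_norm f = fC1 \<and>
    smooth_on_sphere h \<and> (\<forall>x\<in>sphere 0 1. h x > 0) \<and> strictly_convex_on_sphere h \<and>
    (\<forall>x\<in>sphere 0 1. \<forall>e. tangent_frame n x e \<longrightarrow>
       sigma_k k (frame_matrix n e (hess_plus h x)) =
         f x * h x powr (p - 1) *
         ((h x)\<^sup>2 + (norm (sphere_grad h x))\<^sup>2) powr ((real k + 1 - q) / 2))
    \<longrightarrow> (\<forall>x\<in>sphere 0 1.
           ((h x)\<^sup>2 + (norm (sphere_grad h x))\<^sup>2) / h x powr \<gamma>
             \<le> M * (SUP y\<in>sphere 0 1. h y) powr (2 - \<gamma>))"
proof -
  define A where "A = (2 * (fC1 / fmin) + 2 * real k + 2 * (p - 1)) / (2 * (p - 1) - real k * \<gamma>)"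
  have kpos: "real k > 0" using assms(2) by simp
  have \<delta>: "0 < 2 * (p - 1) - real k * \<gamma>" using assms(8) kpos by (simp add: field_simps)
  have "2 * (p - 1) / real k \<le> 2" using assms(5) kpos by (simp add: field_simps)
  then have g2: "\<gamma> < 2" using assms(8) by linarith
  show ?thesis
  proof (intro exI[of _ "max 2 (A\<^sup>2)"] conjI allI impI ballI, simp, elim conjE)
    fix f h :: "'a \<Rightarrow> real" and z :: 'a
    assume z: "z \<in> sphere 0 1"
      and f: "smooth_on_sphere f" "\<forall>x\<in>sphere 0 1. f x > 0"
      and fmin: "(INF x\<in>sphere 0 1. f x) = fmin" and fC1: "C1_norm f = fC1"
      and h: "smooth_on_sphere h" "\<forall>x\<in>sphere 0 1. h x > 0" "strictly_convex_on_sphere h"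
      and eq: "\<forall>x\<in>sphere 0 1. \<forall>e. tangent_frame n x e \<longrightarrow>
       sigma_k k (frame_matrix n e (hess_plus h x)) =
         f x * h x powr (p - 1) *
         ((h x)\<^sup>2 + (norm (sphere_grad h x))\<^sup>2) powr ((real k + 1 - q) / 2)"
    define N where "N x = (h x)\<^sup>2 + (norm (sphere_grad h x))\<^sup>2" for x
    define R where "R = (SUP y\<in>sphere 0 1. h y)"
    have cont: "continuous_on (sphere 0 1) (\<lambda>x. N x / h x powr \<gamma>)"
      unfolding N_def
    proof (intro continuous_on_divide continuous_on_add continuous_on_power continuous_on_powr
        continuous_on_const continuous_on_sphere_smooth[OF h(1)] ballI)
      fix y :: 'a assume "y \<in> sphere 0 1"
      then have "h y > 0" using h(2) by blast
      then show "h y \<noteq> 0" "h y powr \<gamma> \<noteq> 0" by simp_all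
    qed
    have ne: "sphere 0 1 \<noteq> ({} :: 'a set)" by simp
    obtain x where x: "x \<in> sphere 0 1" and mx: "\<forall>y\<in>sphere 0 1. N y / h y powr \<gamma> \<le> N x / h x powr \<gamma>"
      using continuous_attains_sup[OF compact_sphere ne cont] by (elim bexE)
    have xn: "norm x = 1" using x by simp
    have hx: "h x > 0" and fx: "f x > 0" using bspec[OF h(2) x] bspec[OF f(2) x] by simp_all
    have fm: "fmin > 0" "fmin \<le> f x" using INF_sphere_pos[OF f] xn fmin by auto
    have fC: "norm (sphere_grad f x) \<le> fC1" using norm_sphere_grad_le_C1_norm[OF f(1) xn] fC1 by simp
    then have fC0: "0 \<le> fC1" using norm_ge_zero order_trans by blast
    let ?a = "norm (sphere_grad h x)"
    have "(p - 1) * ?a\<^sup>2 / h x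
      \<le> norm (sphere_grad f x) * ?a / f x + real k * (h x + \<gamma> * N x / (2 * h x))"
      unfolding N_def
    proof (rule max_point_estimate[OF assms(1,6,7) g2 f h eq xn])
      fix y :: 'a assume "norm y = 1"
      then have "y \<in> sphere 0 1" by simp
      from bspec[OF mx this]
      show "((h y)\<^sup>2 + (norm (sphere_grad h y))\<^sup>2) / h y powr \<gamma>
        \<le> ((h x)\<^sup>2 + (norm (sphere_grad h x))\<^sup>2) / h x powr \<gamma>"
        unfolding N_def .
    qed
    also have "norm (sphere_grad f x) * ?a / f x \<le> fC1 / fmin * ?a"
    proof -
      have "norm (sphere_grad f x) / f x \<le> fC1 / fmin"
        using fC fC0 fm fx by (intro frac_le) auto
      from mult_right_mono[OF this, of ?a] show ?thesis by simp
    qed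
    finally have est: "(p - 1) * ?a\<^sup>2 / h x
      \<le> fC1 / fmin * ?a + real k * (h x + \<gamma> * ((h x)\<^sup>2 + ?a\<^sup>2) / (2 * h x))"
      by (simp add: N_def)
    have NA: "N x \<le> A\<^sup>2 * (h x)\<^sup>2"
      unfolding N_def A_def
      by (rule estimate_arithmetic[OF est hx]) (use fC0 fm assms(4) \<delta> in auto)
    have hR: "h x \<le> R"
      unfolding R_def by (rule continuous_le_SUP_sphere[OF continuous_on_sphere_smooth(1)[OF h(1)] xn])
    have "N z / h z powr \<gamma> \<le> N x / h x powr \<gamma>" using mx z by blast
    also have "\<dots> \<le> A\<^sup>2 * (h x)\<^sup>2 / h x powr \<gamma>" using NA by (intro divide_right_mono) auto
    also have "\<dots> = A\<^sup>2 * h x powr (2 - \<gamma>)"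
      using hx by (simp add: powr_diff)
    also have "\<dots> \<le> max 2 (A\<^sup>2) * R powr (2 - \<gamma>)"
      using hx hR g2 by (intro mult_mono powr_mono2) auto
    finally show "((h z)\<^sup>2 + (norm (sphere_grad h z))\<^sup>2) / h z powr \<gamma>
        \<le> max 2 (A\<^sup>2) * (SUP y\<in>sphere 0 1. h y) powr (2 - \<gamma>)"
      by (simp add: N_def R_def)
  qed
qed

end
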